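(* Let $x^*$ be a feasible solution of the subtour elimination LP for the $s$-$t$ path TSP on vertex set $V$, and let $G=(V,E)$ be its support graph. If no edge of $G$ is contained in more than two narrow cuts, then $\tfrac32x^*$ is a convex combination of (incidence vectors of) $\{s,t\}$-tours of $G$.
   Context: $V$ is finite and $s,t\in V$. For $U\subseteq V$, $\delta(U)$ is the set of pairs with exactly one endpoint in $U$. The subtour elimination LP for the $s$-$t$ path TSP has constraints $x\ge0$, $\sum_{e\in\delta(\{i\})}x(e)=f(\{i\})$ for all $i\in V$, and $\sum_{e\in\delta(U)}x(e)\ge f(U)$ for all $\emptyset\ne U\subsetneq V$, where $f(U)=1$ if $|U\cap\{s,t\}|=1$ and $f(U)=2$ otherwise. $E=\{e:x^*(e)>0\}$. A narrow cut is a set $Q=\delta(U)\cap E$ ($\emptyset\ne U\subsetneq V$) with $\sum_{e\in Q}x^*(e)<2$. An $\{s,t\}$-tour is a multiset of edges of $E$ forming a connected spanning multigraph on $V$ whose set of odd-degree vertices is $\{s\}\triangle\{t\}$. *)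

theory Defs
  imports "HOL-Analysis.Analysis" "HOL-Library.Multiset"
begin

definition vertex_pairs :: "'a set \<Rightarrow> 'a set set" where
  "vertex_pairs V = {e. e \<subseteq> V \<and> card e = 2}"

definition cut_edges :: "'a set \<Rightarrow> 'a set \<Rightarrow> 'a set set" where
  "cut_edges V U = {e \<in> vertex_pairs V. card (e \<inter> U) = 1}"

definition cut_demand :: "'a \<Rightarrow> 'a \<Rightarrow> 'a set \<Rightarrow> real" where
  "cut_demand s t U = (if card (U \<inter> {s, t}) = 1 then 1 else 2)"

(* The variables of the LP are the values of x on vertex_pairs V; values of x
   elsewhere are irrelevant here and in all definitions below. *)
definition subtour_feasible :: "'a set \<Rightarrow> 'a \<Rightarrow> 'a \<Rightarrow> ('a set \<Rightarrow> real) \<Rightarrow> bool" where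
  "subtour_feasible V s t x \<longleftrightarrow>
     (\<forall>e \<in> vertex_pairs V. 0 \<le> x e) \<and>
     (\<forall>i \<in> V. (\<Sum>e \<in> cut_edges V {i}. x e) = cut_demand s t {i}) \<and>
     (\<forall>U. U \<noteq> {} \<and> U \<subset> V \<longrightarrow> (\<Sum>e \<in> cut_edges V U. x e) \<ge> cut_demand s t U)"

definition support_edges :: "'a set \<Rightarrow> ('a set \<Rightarrow> real) \<Rightarrow> 'a set set" where
  "support_edges V x = {e \<in> vertex_pairs V. x e > 0}"

(* Narrow cuts are sets of edges: U and V - U give the same one, and they are
   counted without multiplicity. *)
definition narrow_cuts :: "'a set \<Rightarrow> ('a set \<Rightarrow> real) \<Rightarrow> 'a set set set" where
  "narrow_cuts V x =
     {Q. \<exists>U. U \<noteq> {} \<and> U \<subset> V \<and> Q = cut_edges V U \<inter> support_edges V x \<and> (\<Sum>e \<in> Q. x e) < 2}"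

definition multigraph_connected :: "'a set \<Rightarrow> 'a set multiset \<Rightarrow> bool" where
  "multigraph_connected V J \<longleftrightarrow>
     (\<forall>u \<in> V. \<forall>v \<in> V. (u, v) \<in> {(a, b). {a, b} \<in># J}\<^sup>*)"

(* Counts incident edges with multiplicity; the edges it is applied to have two
   distinct endpoints, so loops do not arise. *)
definition multigraph_degree :: "'a set multiset \<Rightarrow> 'a \<Rightarrow> nat" where
  "multigraph_degree J v = size (filter_mset (\<lambda>e. v \<in> e) J)"

definition st_tour :: "'a set \<Rightarrow> 'a set set \<Rightarrow> 'a \<Rightarrow> 'a \<Rightarrow> 'a set multiset \<Rightarrow> bool" where
  "st_tour V E s t J \<longleftrightarrow>
     set_mset J \<subseteq> E \<and>
     multigraph_connected V J \<and>
     {v \<in> V. odd (multigraph_degree J v)} = sym_diff {s} {t}"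

(* The incidence vector of J is the map count J; coordinates are indexed by D. *)
definition convex_comb_of_incidence_vectors ::
    "'b set \<Rightarrow> 'b multiset set \<Rightarrow> ('b \<Rightarrow> real) \<Rightarrow> bool" where
  "convex_comb_of_incidence_vectors D \<J> y \<longleftrightarrow>
     (\<exists>F w. finite F \<and> F \<subseteq> \<J> \<and> (\<forall>J \<in> F. 0 \<le> w J) \<and> (\<Sum>J \<in> F. w J) = 1 \<and>
        (\<forall>e \<in> D. y e = (\<Sum>J \<in> F. w J * real (count J e))))"

end

theory Submission
  imports Defs "HOL-Probability.Probability_Mass_Function"
begin

text \<open>
  Feasibility forces \<open>s \<noteq> t\<close>, and \<open>x\<close> is a mixture of spanning trees \<open>S\<close>. For a narrow cut \<open>C\<close>, the
  probability that \<open>S\<close> meets \<open>C\<close> in a single (lonely) edge is at least \<open>2 - x(C)\<close>, because \<open>S\<close> always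
  meets \<open>C\<close> and does so \<open>x(C)\<close> times on average. Narrow cuts form a chain, so when no edge is in more
  than two of them, alternating two colours along the chain puts every edge in at most one narrow
  cut of each colour. Delete from \<open>S\<close> the lonely edges of the narrow cuts of a random colour. This
  saves half of the mean lonely-edge vector, and adding that half to \<open>x/2\<close> gives a vector of
  value at least 1 on every cut, hence one that dominates a mixture of \<open>T\<close>-joins for every even \<open>T\<close>.
  The \<open>T\<close>-join \<open>J\<close> correcting the parities of the remaining forest \<open>F\<close> must meet each cut whose lonely
  edge was deleted, and it reconnects the two adjacent levels there, since none of its edges crosses
  two cuts of the same colour. So \<open>F + J\<close> is a tour, of mean at most \<open>x + x/2\<close>; the slack is filled by
  doubled edges.

  Edges are elements \<open>e\<close> of an abstract type with end vertices \<open>l e\<close> and \<open>r e\<close>, so that contracting a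
  vertex set only changes \<open>l\<close> and \<open>r\<close>.
\<close>

section \<open>Dominated mixtures\<close>

text \<open>Why colours: an edge of \<open>J\<close> crossing two cuts that both lost their lonely
  edges repairs the parity of both, yet it may leave the level between them unattached. Why
  \<open>J\<close> must meet a cut that lost its lonely edge: nothing of \<open>F\<close> crosses it
  any more although it separates \<open>s\<close> from \<open>t\<close>, so its parity is wrong. Why
  the constants fit: let m be the mean lonely-edge vector, summed over all narrow cuts. Half of
  \<open>x\<close> plus half of m has value at least x(C)/2 >= 1 on a cut C that is not narrow, and
  at least x(C)/2 + (2 - x(C))/2 = 1 on a narrow one. Averaged over the two colours, the forest
  costs at most x - m/2 and the join at most x/2 + m/2; the lonely edges cancel. Both polyhedral
  theorems only ask a mixture to stay below a given vector in each coordinate. Equality is restored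
  once, at the very end, where an even number of copies of an edge disturbs neither connectivity nor
  parity.\<close>

lemma slack_step:
  fixes g r :: "'i \<Rightarrow> real"
  assumes fin: "finite I" and nonneg: "\<And>i. i \<in> I \<Longrightarrow> 0 \<le> g i"
    and tight: "\<And>i. i \<in> I \<Longrightarrow> g i = 0 \<Longrightarrow> r i = 0" and neg: "\<exists>i\<in>I. r i < 0"
  obtains \<epsilon> where "\<epsilon> > 0" "\<And>i. i \<in> I \<Longrightarrow> 0 \<le> g i + \<epsilon> * r i"
    "card {i \<in> I. g i + \<epsilon> * r i > 0} < card {i \<in> I. g i > 0}"
proof -
  define K where "K = {i \<in> I. r i < 0}"
  \<comment> \<open>Ratio test: the largest step that keeps all slacks nonnegative. An index
    attaining the minimum loses its slack, and \<open>tight\<close> keeps vanished slacks at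
    0.\<close>
  define \<epsilon> where "\<epsilon> = Min ((\<lambda>i. g i / - r i) ` K)"
  have K: "finite K" "K \<noteq> {}" using fin neg by (auto simp: K_def)
  have "\<epsilon> \<in> (\<lambda>i. g i / - r i) ` K" unfolding \<epsilon>_def using K by (intro Min_in) auto
  then obtain k where k: "k \<in> K" "\<epsilon> = g k / - r k" by auto
  have gpos: "g i > 0" if "i \<in> I" "r i \<noteq> 0" for i using nonneg[of i] tight[of i] that by force
  have gk: "g k > 0" "r k < 0" "k \<in> I" using k gpos[of k] by (auto simp: K_def)
  have eps: "\<epsilon> > 0" using gk k by (simp add: divide_pos_neg)
  have le: "\<epsilon> \<le> g i / - r i" if "i \<in> K" for i unfolding \<epsilon>_def using K that by (intro Min_le) auto
  have nn: "0 \<le> g i + \<epsilon> * r i" if "i \<in> I" for i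
  proof (cases "r i < 0")
    case True
    then show ?thesis using le[of i] that by (simp add: K_def field_simps)
  next
    case False
    then show ?thesis using nonneg[OF that] eps by simp
  qed
  have "{i \<in> I. g i + \<epsilon> * r i > 0} \<subset> {i \<in> I. g i > 0}"
  proof
    show "{i \<in> I. g i + \<epsilon> * r i > 0} \<subseteq> {i \<in> I. g i > 0}"
      using nonneg tight gpos by force
    have "g k + \<epsilon> * r k = 0" using k gk by (simp add: field_simps)
    then show "{i \<in> I. g i + \<epsilon> * r i > 0} \<noteq> {i \<in> I. g i > 0}" using gk by force
  qed
  then have "card {i \<in> I. g i + \<epsilon> * r i > 0} < card {i \<in> I. g i > 0}"
    using fin by (intro psubset_card_mono) auto
  then show thesis using that eps nn by blast
qed

text \<open>Gaussian elimination: an equation with a nonzero coefficient at \<open>k\<close>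
  eliminates that unknown, leaving one equation and one unknown fewer.\<close>

lemma homogeneous_system_nontrivial:
  fixes M :: "'a \<Rightarrow> 'e \<Rightarrow> real"
  assumes "finite A" "finite H" "card A < card H"
  shows "\<exists>d. (\<exists>e\<in>H. d e \<noteq> 0) \<and> (\<forall>a\<in>A. (\<Sum>e\<in>H. M a e * d e) = 0)"
  using assms
proof (induction A arbitrary: H M rule: finite_induct)
  case empty
  then show ?case by (intro exI[of _ "\<lambda>_. 1"]) (auto simp: card_gt_0_iff)
next
  case (insert a A)
  show ?case
  proof (cases "\<forall>e\<in>H. M a e = 0")
    case True
    obtain d where "\<exists>e\<in>H. d e \<noteq> 0" "\<forall>a\<in>A. (\<Sum>e\<in>H. M a e * d e) = 0"
      using insert.IH[of H M] insert.prems insert.hyps by fastforce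
    then show ?thesis using True by (intro exI[of _ d]) auto
  next
    case False
    then obtain k where k: "k \<in> H" "M a k \<noteq> 0" by auto
    define H' where "H' = H - {k}"
    have H': "finite H'" "k \<notin> H'" "H = insert k H'" using insert k by (auto simp: H'_def)
    \<comment> \<open>Row \<open>b\<close> minus the multiple of row \<open>a\<close> that clears
      column \<open>k\<close>.\<close>
    define M' where "M' = (\<lambda>b e. M b e - M b k * M a e / M a k)"
    have "card A < card H'" using insert k H' by auto
    then obtain d' where d': "\<exists>e\<in>H'. d' e \<noteq> 0" "\<And>b. b \<in> A \<Longrightarrow> (\<Sum>e\<in>H'. M' b e * d' e) = 0"
      using insert.IH[of H' M'] H' by auto
    define c where "c = (\<Sum>e\<in>H'. M a e * d' e)"
    define d where "d = d'(k := - c / M a k)"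
    have sum_d: "(\<Sum>e\<in>H. M b e * d e) = - M b k * c / M a k + (\<Sum>e\<in>H'. M b e * d' e)" for b
    proof -
      have "(\<Sum>e\<in>H'. M b e * d e) = (\<Sum>e\<in>H'. M b e * d' e)"
        using H' by (intro sum.cong) (auto simp: d_def)
      then show ?thesis using H' by (simp add: d_def)
    qed
    have "(\<Sum>e\<in>H. M b e * d e) = 0" if "b \<in> A" for b
    proof -
      have "(\<Sum>e\<in>H'. M' b e * d' e) = (\<Sum>e\<in>H'. M b e * d' e) - M b k / M a k * c"
        by (simp add: M'_def c_def algebra_simps sum_subtractf sum_distrib_left sum_distrib_right)
      then show ?thesis using d'(2)[OF that] sum_d[of b] by (simp add: field_simps)
    qed
    moreover have "(\<Sum>e\<in>H. M a e * d e) = 0" using sum_d[of a] k by (simp add: c_def)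
    moreover have "\<exists>e\<in>H. d e \<noteq> 0" using d'(1) H' by (auto simp: d_def)
    ultimately show ?thesis by (intro exI[of _ d]) auto
  qed
qed

section \<open>Random edge sets and their marginals\<close>

abbreviation marginal :: "'e set pmf \<Rightarrow> 'e \<Rightarrow> real" where
  "marginal p e \<equiv> measure_pmf.expectation p (\<lambda>J. of_bool (e \<in> J))"

lemma expectation_bind_pmf:
  fixes h :: "'b \<Rightarrow> real"
  assumes "finite (set_pmf p)" "\<And>x. x \<in> set_pmf p \<Longrightarrow> finite (set_pmf (f x))"
  shows "measure_pmf.expectation (bind_pmf p f) h
    = measure_pmf.expectation p (\<lambda>x. measure_pmf.expectation (f x) h)"
  using assms by (simp add: pmf_expectation_bind[of "set_pmf p"] integral_measure_pmf[of "set_pmf p"])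

lemma expectation_mono_finite:
  fixes g h :: "'b \<Rightarrow> real"
  assumes "finite (set_pmf p)" "\<And>x. x \<in> set_pmf p \<Longrightarrow> g x \<le> h x"
  shows "measure_pmf.expectation p g \<le> measure_pmf.expectation p h"
  using assms by (intro integral_mono_AE) (auto simp: AE_measure_pmf_iff integrable_measure_pmf_finite)

lemma expectation_cong:
  fixes g h :: "'b \<Rightarrow> real"
  assumes "\<And>x. x \<in> set_pmf p \<Longrightarrow> g x = h x"
  shows "measure_pmf.expectation p g = measure_pmf.expectation p h"
  using assms by (intro integral_cong_AE) (auto simp: AE_measure_pmf_iff)

lemma sum_of_bool_mult:
  fixes z :: "'e \<Rightarrow> real"
  assumes "finite E"
  shows "(\<Sum>e\<in>E. of_bool (P e) * z e) = (\<Sum>e | e \<in> E \<and> P e. z e)"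
proof -
  have "(\<Sum>e\<in>E. of_bool (P e) * z e) = (\<Sum>e\<in>E. if P e then z e else 0)" by (intro sum.cong) auto
  then show ?thesis using assms by (simp add: sum.inter_filter)
qed

text \<open>Upper bounds instead of equalities make the property monotone in \<open>y\<close>, which
  suits the upward closed T-join polyhedron. The bound \<open>Pow E\<close> makes every such mixture
  finite once \<open>E\<close> is finite.\<close>

definition dominates_mixture :: "'e set \<Rightarrow> 'e set set \<Rightarrow> ('e \<Rightarrow> real) \<Rightarrow> bool" where
  "dominates_mixture E \<F> y \<longleftrightarrow>
     (\<exists>p. set_pmf p \<subseteq> \<F> \<inter> Pow E \<and> (\<forall>e\<in>E. marginal p e \<le> y e))"

lemma dominates_mixture_mono:
  "dominates_mixture E \<F> y \<Longrightarrow> (\<And>e. e \<in> E \<Longrightarrow> y e \<le> z e) \<Longrightarrow> dominates_mixture E \<F> z"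
  unfolding dominates_mixture_def by (meson order_trans)

text \<open>A coin with bias \<open>c\<close> decides which of the two mixtures is sampled.\<close>

lemma dominates_mixture_convex:
  assumes "finite E" "dominates_mixture E \<F> y" "dominates_mixture E \<F> z" "0 \<le> c" "c \<le> 1"
  shows "dominates_mixture E \<F> (\<lambda>e. c * y e + (1 - c) * z e)"
proof -
  obtain p q where p: "set_pmf p \<subseteq> \<F> \<inter> Pow E" "\<forall>e\<in>E. marginal p e \<le> y e"
    and q: "set_pmf q \<subseteq> \<F> \<inter> Pow E" "\<forall>e\<in>E. marginal q e \<le> z e"
    using assms unfolding dominates_mixture_def by auto
  define r where "r = bind_pmf (bernoulli_pmf c) (\<lambda>b. if b then p else q)"
  have fin: "finite (set_pmf p)" "finite (set_pmf q)"
    using p q assms(1) by (auto intro: finite_subset[of _ "Pow E"])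
  have "marginal r e = c * marginal p e + (1 - c) * marginal q e" for e
    unfolding r_def using fin assms(4,5)
    by (subst expectation_bind_pmf) (auto intro: finite_subset[OF subset_UNIV])
  then have "marginal r e \<le> c * y e + (1 - c) * z e" if "e \<in> E" for e
    using p q that assms(4,5) by (simp add: add_mono mult_left_mono)
  moreover have "set_pmf r \<subseteq> \<F> \<inter> Pow E"
  proof -
    have "set_pmf r \<subseteq> set_pmf p \<union> set_pmf q" by (auto simp: r_def split: if_splits)
    then show ?thesis using p q by blast
  qed
  ultimately show ?thesis unfolding dominates_mixture_def by blast
qed

text \<open>Moving along a direction that keeps tight constraints tight, until a new constraint
  becomes tight; this is how both inductions below avoid extreme points.\<close>

lemma dominates_mixture_perturb:
  fixes y d :: "'e \<Rightarrow> real" and a :: "'i \<Rightarrow> 'e \<Rightarrow> real" and b :: "'i \<Rightarrow> real"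
  assumes fin: "finite E" "finite I"
    and feas: "\<And>e. e \<in> E \<Longrightarrow> 0 \<le> y e" "\<And>i. i \<in> I \<Longrightarrow> b i \<le> (\<Sum>e\<in>E. a i e * y e)"
    and tight0: "\<And>e. e \<in> E \<Longrightarrow> y e = 0 \<Longrightarrow> d e = 0"
    and tight: "\<And>i. i \<in> I \<Longrightarrow> (\<Sum>e\<in>E. a i e * y e) = b i \<Longrightarrow> (\<Sum>e\<in>E. a i e * d e) = 0"
    and nz: "\<exists>e\<in>E. d e \<noteq> 0"
    and IH: "\<And>z k. (\<And>e. e \<in> E \<Longrightarrow> 0 \<le> z e) \<Longrightarrow> (\<And>i. i \<in> I \<Longrightarrow> b i \<le> (\<Sum>e\<in>E. a i e * z e)) \<Longrightarrow>
      (\<And>e. e \<in> E \<Longrightarrow> z e = y e + k * d e) \<Longrightarrow>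
      card {e\<in>E. 0 < z e} + card {i\<in>I. b i < (\<Sum>e\<in>E. a i e * z e)}
       < card {e\<in>E. 0 < y e} + card {i\<in>I. b i < (\<Sum>e\<in>E. a i e * y e)} \<Longrightarrow>
      dominates_mixture E \<F> z"
  shows "dominates_mixture E \<F> y"
proof -
  have card_sum: "card {u \<in> E <+> I. case_sum f g u} = card {e\<in>E. f e} + card {i\<in>I. g i}" for f g
  proof -
    have "{u \<in> E <+> I. case_sum f g u} = {e\<in>E. f e} <+> {i\<in>I. g i}" by auto
    then show ?thesis using fin by (simp add: card_Plus)
  qed
  have step: "\<exists>\<epsilon>>0. dominates_mixture E \<F> (\<lambda>e. y e + \<epsilon> * (\<sigma> * d e))"
    if neg: "\<exists>e\<in>E. \<sigma> * d e < 0" for \<sigma>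
  proof -
    \<comment> \<open>Nonnegativity and the rows form one system over a disjoint sum:
      \<open>g\<close> is the slack of a constraint and \<open>r\<close> its rate of change along
      \<open>\<sigma> * d\<close>.\<close>
    define g where "g = case_sum y (\<lambda>i. (\<Sum>e\<in>E. a i e * y e) - b i)"
    define r where "r = case_sum (\<lambda>e. \<sigma> * d e) (\<lambda>i. \<sigma> * (\<Sum>e\<in>E. a i e * d e))"
    obtain \<epsilon> where \<epsilon>: "\<epsilon> > 0" "\<And>u. u \<in> E <+> I \<Longrightarrow> 0 \<le> g u + \<epsilon> * r u"
      "card {u \<in> E <+> I. g u + \<epsilon> * r u > 0} < card {u \<in> E <+> I. g u > 0}"
    proof (rule slack_step[of "E <+> I" g r])
      show "\<exists>u\<in>E <+> I. r u < 0" using neg by (auto simp: r_def intro!: bexI[of _ "Inl _"])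
    qed (use fin feas tight0 tight in \<open>auto simp: g_def r_def\<close>)
    define z where "z = (\<lambda>e. y e + \<epsilon> * (\<sigma> * d e))"
    have az: "(\<Sum>e\<in>E. a i e * z e) = (\<Sum>e\<in>E. a i e * y e) + \<epsilon> * (\<sigma> * (\<Sum>e\<in>E. a i e * d e))" for i
      by (simp add: z_def algebra_simps sum.distrib sum_distrib_left)
    have gz: "g u + \<epsilon> * r u = case_sum z (\<lambda>i. (\<Sum>e\<in>E. a i e * z e) - b i) u" for u
      by (cases u) (simp_all add: g_def r_def az, simp add: z_def)
    have pos: "(case_sum z' (\<lambda>i. (\<Sum>e\<in>E. a i e * z' e) - b i) u > 0)
       = case_sum (\<lambda>e. 0 < z' e) (\<lambda>i. b i < (\<Sum>e\<in>E. a i e * z' e)) u" for z' u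
      by (cases u) auto
    have "dominates_mixture E \<F> z"
    proof (rule IH[where k = "\<epsilon> * \<sigma>"])
      show "0 \<le> z e" if "e \<in> E" for e using \<epsilon>(2)[of "Inl e"] that by (simp add: gz InlI)
      show "b i \<le> (\<Sum>e\<in>E. a i e * z e)" if "i \<in> I" for i
        using \<epsilon>(2)[of "Inr i"] that by (simp add: gz InrI)
      show "z e = y e + \<epsilon> * \<sigma> * d e" for e by (simp add: z_def)
      show "card {e\<in>E. 0 < z e} + card {i\<in>I. b i < (\<Sum>e\<in>E. a i e * z e)}
       < card {e\<in>E. 0 < y e} + card {i\<in>I. b i < (\<Sum>e\<in>E. a i e * y e)}"
        using \<epsilon>(3) unfolding gz unfolding g_def pos card_sum .
    qed
    then show ?thesis using \<epsilon>(1) by (auto simp: z_def)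
  qed
  \<comment> \<open>A step is bounded only if some coordinate decreases. If \<open>d\<close> has
    both signs, \<open>y\<close> lies between the end points of a forward and a backward step;
    otherwise step downwards and use monotonicity.\<close>
  consider "\<exists>e\<in>E. d e < 0" "\<exists>e\<in>E. d e > 0" | "\<forall>e\<in>E. d e \<le> 0" | "\<forall>e\<in>E. d e \<ge> 0"
    by (meson leI)
  then show ?thesis
  proof cases
    case 1
    obtain m n where mn: "m > 0" "n > 0" "dominates_mixture E \<F> (\<lambda>e. y e + m * (1 * d e))"
      "dominates_mixture E \<F> (\<lambda>e. y e + n * (- 1 * d e))"
      using step[of 1] step[of "- 1"] 1 by auto
    \<comment> \<open>The weight at which the steps cancel:
      \<open>c * m = (1 - c) * n\<close>.\<close>
    define c where "c = n / (m + n)"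
    have c: "0 \<le> c" "c \<le> 1" "c * (m + n) = n" using mn by (auto simp: c_def)
    have "c * (y e + m * (1 * d e)) + (1 - c) * (y e + n * (- 1 * d e)) = y e + (c * (m + n) - n) * d e" for e
      by (simp add: algebra_simps)
    then have "c * (y e + m * (1 * d e)) + (1 - c) * (y e + n * (- 1 * d e)) = y e" for e
      using c by simp
    then show ?thesis using dominates_mixture_convex[OF fin(1) mn(3,4) c(1,2)] by simp
  next
    case 2
    then obtain m where "m > 0" "dominates_mixture E \<F> (\<lambda>e. y e + m * (1 * d e))"
      using step[of 1] nz by force
    then show ?thesis using 2 by (auto intro: dominates_mixture_mono simp: mult_nonneg_nonpos)
  next
    case 3
    then obtain m where "m > 0" "dominates_mixture E \<F> (\<lambda>e. y e + m * (- 1 * d e))"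
      using step[of "- 1"] nz by force
    then show ?thesis using 3 by (auto intro: dominates_mixture_mono)
  qed
qed

section \<open>The spanning tree polytope\<close>

definition crosses :: "('e \<Rightarrow> 'v) \<Rightarrow> ('e \<Rightarrow> 'v) \<Rightarrow> 'v set \<Rightarrow> 'e \<Rightarrow> bool" where
  "crosses l r U e \<longleftrightarrow> (l e \<in> U) \<noteq> (r e \<in> U)"

definition inside :: "('e \<Rightarrow> 'v) \<Rightarrow> ('e \<Rightarrow> 'v) \<Rightarrow> 'v set \<Rightarrow> 'e \<Rightarrow> bool" where
  "inside l r U e \<longleftrightarrow> l e \<in> U \<and> r e \<in> U"

text \<open>Connectivity through cuts, the form in which contraction and the LP constraints speak of
  it; cycles are allowed.\<close>

definition connected_edges :: "'v set \<Rightarrow> ('e \<Rightarrow> 'v) \<Rightarrow> ('e \<Rightarrow> 'v) \<Rightarrow> 'e set \<Rightarrow> bool" where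
  "connected_edges V l r S \<longleftrightarrow> (\<forall>U. U \<subseteq> V \<and> U \<noteq> {} \<and> U \<noteq> V \<longrightarrow> (\<exists>e\<in>S. crosses l r U e))"

text \<open>Contraction of \<open>W\<close> onto a representative, to be composed with the end maps.
  The vertex type stays the same, so an induction hypothesis applies to the contracted
  graph.\<close>

definition shrink :: "'v set \<Rightarrow> 'v \<Rightarrow> 'v \<Rightarrow> 'v" where
  "shrink W w v = (if v \<in> W then w else v)"

lemma card_shrink:
  assumes "finite V" "W \<subseteq> V" "w \<in> W"
  shows "card (insert w (V - W)) = card V - card W + 1"
  using assms by (simp add: card_Diff_subset finite_subset)

text \<open>A vertex set that splits \<open>W\<close> is crossed by an edge of \<open>S1\<close>
  inside \<open>W\<close>; one that does not split \<open>W\<close> is the preimage of a vertex set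
  of the contracted graph.\<close>

lemma connected_edges_Un_shrink:
  assumes W: "W \<subseteq> V" "w \<in> W"
    and S1: "connected_edges W l r S1"
    and S2: "connected_edges (insert w (V - W)) (shrink W w \<circ> l) (shrink W w \<circ> r) S2"
    and ends: "\<And>e. e \<in> S1 \<union> S2 \<Longrightarrow> inside l r V e" "\<And>e. e \<in> S1 \<Longrightarrow> inside l r W e"
  shows "connected_edges V l r (S1 \<union> S2)"
  unfolding connected_edges_def
proof (intro allI impI)
  fix U assume "U \<subseteq> V \<and> U \<noteq> {} \<and> U \<noteq> V"
  then have U: "U \<subseteq> V" "U \<noteq> {}" "U \<noteq> V" by auto
  show "\<exists>e\<in>S1 \<union> S2. crosses l r U e"
  proof (cases "U \<inter> W = {} \<or> W \<subseteq> U")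
    case False
    then have "U \<inter> W \<subseteq> W" "U \<inter> W \<noteq> {}" "U \<inter> W \<noteq> W" by auto
    then obtain e where "e \<in> S1" "crosses l r (U \<inter> W) e"
      using S1 unfolding connected_edges_def by blast
    then show ?thesis using ends(2)[of e] by (auto simp: crosses_def inside_def)
  next
    case True
    define U' where "U' = U - W \<union> (if W \<subseteq> U then {w} else {})"
    have "U' \<subseteq> insert w (V - W)" "U' \<noteq> {}" "U' \<noteq> insert w (V - W)"
      using U W True by (auto simp: U'_def split: if_splits)
    then obtain e where e: "e \<in> S2" "crosses (shrink W w \<circ> l) (shrink W w \<circ> r) U' e"
      using S2 unfolding connected_edges_def by blast
    have "shrink W w v \<in> U' \<longleftrightarrow> v \<in> U" for v using True W by (auto simp: shrink_def U'_def)
    then show ?thesis using e by (auto simp: crosses_def)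
  qed
qed

text \<open>Induction on the number of vertices, then on the number of strict constraints. A tight
  set \<open>W\<close> with \<open>2 \<le> card W\<close> and \<open>W \<subset> V\<close> splits
  the problem into \<open>W\<close> and the graph with \<open>W\<close> contracted. Without such a
  set, weight can be shifted between any two positive edges. With only one positive edge
  \<open>e\<close>, the total is \<open>x e\<close>, and the constraint for its ends forces
  \<open>card V \<le> 2\<close>.\<close>

theorem spanning_tree_decomposition:
  fixes V :: "'v set" and E :: "'e set" and x :: "'e \<Rightarrow> real"
  assumes "finite V" "V \<noteq> {}" "finite E" "\<And>e. e \<in> E \<Longrightarrow> inside l r V e"
    and "\<And>e. e \<in> E \<Longrightarrow> 0 \<le> x e"
    and "\<And>U. U \<subseteq> V \<Longrightarrow> U \<noteq> {} \<Longrightarrow> (\<Sum>e | e \<in> E \<and> inside l r U e. x e) \<le> real (card U) - 1"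
    and "(\<Sum>e\<in>E. x e) = real (card V) - 1"
  shows "dominates_mixture E {S. connected_edges V l r S} x"
  using assms
proof (induction "(card V, card {e\<in>E. 0 < x e} + card {U. U \<subseteq> V \<and> U \<noteq> {} \<and>
      (\<Sum>e | e \<in> E \<and> inside l r U e. x e) < real (card U) - 1})" arbitrary: V E l r x
    rule: wf_induct_rule[OF wf_lex_prod[OF wf_less_than wf_less_than]])
  case (1 V E l r x)
  note IH = "1.hyps" and finV = "1.prems"(1) and ne = "1.prems"(2) and finE = "1.prems"(3)
    and ends = "1.prems"(4) and nonneg = "1.prems"(5) and small = "1.prems"(6) and total = "1.prems"(7)
  show ?case
  proof (cases "\<exists>W. W \<subset> V \<and> 2 \<le> card W \<and> (\<Sum>e | e \<in> E \<and> inside l r W e. x e) = real (card W) - 1")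
    case True
    then obtain W where W: "W \<subset> V" "2 \<le> card W"
      "(\<Sum>e | e \<in> E \<and> inside l r W e. x e) = real (card W) - 1" by auto
    then obtain w where w: "w \<in> W" by fastforce
    have finW: "finite W" using W finV by (meson finite_subset psubset_imp_subset)
    define E1 where "E1 = {e\<in>E. inside l r W e}"
    define E2 where "E2 = {e\<in>E. \<not> inside l r W e}"
    define V2 where "V2 = insert w (V - W)"
    have cardV2: "card V2 = card V - card W + 1" unfolding V2_def using finV W w by (intro card_shrink) auto
    have cW: "card W < card V" using W finV by (simp add: psubset_card_mono)
    have "dominates_mixture E1 {S. connected_edges W l r S} x"
    proof (rule IH)
      fix U assume U: "U \<subseteq> W" "U \<noteq> {}"
      have "{e. e \<in> E1 \<and> inside l r U e} = {e. e \<in> E \<and> inside l r U e}"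
        using U by (auto simp: E1_def inside_def)
      then show "(\<Sum>e | e \<in> E1 \<and> inside l r U e. x e) \<le> real (card U) - 1"
        using small[of U] U W by auto
    qed (use cW finW w finE nonneg W in \<open>auto simp: E1_def\<close>)
    then obtain p1 where p1: "set_pmf p1 \<subseteq> {S. connected_edges W l r S} \<inter> Pow E1"
      "\<forall>e\<in>E1. marginal p1 e \<le> x e" by (auto simp: dominates_mixture_def)
    let ?l = "shrink W w \<circ> l" and ?r = "shrink W w \<circ> r"
    have "dominates_mixture E2 {S. connected_edges V2 ?l ?r S} x"
    proof (rule IH)
      show "inside ?l ?r V2 e" if "e \<in> E2" for e
        using that ends[of e] by (auto simp: E2_def V2_def inside_def shrink_def)
      have split: "(\<Sum>e | e \<in> E \<and> P e. x e) = (\<Sum>e | e \<in> E2 \<and> P e. x e) + (real (card W) - 1)"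
        if "\<And>e. e \<in> E1 \<Longrightarrow> P e" for P
      proof -
        have "{e. e \<in> E \<and> P e} = {e. e \<in> E2 \<and> P e} \<union> {e. e \<in> E \<and> inside l r W e}"
          using that by (auto simp: E1_def E2_def)
        then show ?thesis using W(3) finE
          by (simp add: sum.union_disjoint E2_def disjoint_iff)
      qed
      fix U assume U: "U \<subseteq> V2" "U \<noteq> {}"
      \<comment> \<open>Preimage of \<open>U\<close> under the contraction. If it contains
        \<open>W\<close>, its size and the weight inside it both exceed those of \<open>U\<close> by
        \<open>card W - 1\<close>, so the bound carries over.\<close>
      define U' where "U' = (if w \<in> U then U \<union> W else U)"
      have U': "U' \<subseteq> V" "U' \<noteq> {}" using U W w by (auto simp: U'_def V2_def split: if_splits)
      have fU: "finite U" using U finV by (auto simp: V2_def intro: finite_subset)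
      have mem: "shrink W w v \<in> U \<longleftrightarrow> v \<in> U'" for v
        using U w by (auto simp: shrink_def U'_def V2_def)
      show "(\<Sum>e | e \<in> E2 \<and> inside ?l ?r U e. x e) \<le> real (card U) - 1"
      proof (cases "w \<in> U")
        case True
        have "U' = (U - {w}) \<union> W" "(U - {w}) \<inter> W = {}" using U w True by (auto simp: U'_def V2_def)
        then have "card U' = card U - 1 + card W" using fU finW True by (simp add: card_Un_disjoint)
        moreover have "card U > 0" using fU True by (auto simp: card_gt_0_iff)
        ultimately have "real (card U') = real (card U) - 1 + real (card W)" by (simp add: of_nat_diff)
        moreover have "(\<Sum>e | e \<in> E \<and> inside l r U' e. x e)
            = (\<Sum>e | e \<in> E2 \<and> inside l r U' e. x e) + (real (card W) - 1)"
          by (rule split) (use True in \<open>auto simp: E1_def inside_def U'_def\<close>)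
        ultimately show ?thesis using small[OF U'] by (simp add: inside_def mem)
      next
        case False
        have "{e. e \<in> E2 \<and> inside l r U e} = {e. e \<in> E \<and> inside l r U e}"
          using False U by (auto simp: E2_def inside_def V2_def)
        then show ?thesis using small[OF U'] mem False by (simp add: inside_def U'_def)
      qed
    next
      have "(\<Sum>e\<in>E. x e) = (\<Sum>e\<in>E2. x e) + (\<Sum>e\<in>E1. x e)"
        using finE by (subst sum.union_disjoint[symmetric]) (auto simp: E1_def E2_def intro!: sum.cong)
      moreover have "(\<Sum>e\<in>E1. x e) = real (card W) - 1" using W(3) by (simp add: E1_def)
      ultimately show "(\<Sum>e\<in>E2. x e) = real (card V2) - 1"
        using total cardV2 cW by (simp add: of_nat_diff)
    qed (use cardV2 cW W finV finE nonneg in \<open>auto simp: V2_def E2_def\<close>)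
    then obtain p2 where p2: "set_pmf p2 \<subseteq> {S. connected_edges V2 ?l ?r S} \<inter> Pow E2"
      "\<forall>e\<in>E2. marginal p2 e \<le> x e" by (auto simp: dominates_mixture_def)
    \<comment> \<open>Independent samples suffice: they lie in the disjoint sets \<open>E1\<close>
      and \<open>E2\<close>, so the marginal at an edge depends on one of them only.\<close>
    define p where "p = map_pmf (\<lambda>(S1, S2). S1 \<union> S2) (pair_pmf p1 p2)"
    have "set_pmf p \<subseteq> {S. connected_edges V l r S} \<inter> Pow E"
    proof -
      have "connected_edges V l r (S1 \<union> S2)" "S1 \<union> S2 \<subseteq> E" if "S1 \<in> set_pmf p1" "S2 \<in> set_pmf p2" for S1 S2
      proof -
        have "S1 \<subseteq> E1" "S2 \<subseteq> E2" using that p1 p2 by auto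
        then show "S1 \<union> S2 \<subseteq> E" by (auto simp: E1_def E2_def)
        show "connected_edges V l r (S1 \<union> S2)"
          by (rule connected_edges_Un_shrink[of W V w])
             (use that p1 p2 W w ends in \<open>force simp: V2_def E1_def E2_def\<close>)+
      qed
      then show ?thesis by (force simp: p_def)
    qed
    moreover have "marginal p e \<le> x e" if "e \<in> E" for e
    proof (cases "inside l r W e")
      case True
      have "marginal p e = measure_pmf.expectation (pair_pmf p1 p2) (\<lambda>z. of_bool (e \<in> fst z))"
        unfolding p_def integral_map_pmf
        by (rule expectation_cong) (use p2 True in \<open>auto simp: E2_def\<close>)
      also have "\<dots> = marginal p1 e"
        by (rule expectation_pair_pmf_fst[where f = "\<lambda>J. of_bool (e \<in> J)"])
      finally show ?thesis using p1 that True by (simp add: E1_def)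
    next
      case False
      have "marginal p e = measure_pmf.expectation (pair_pmf p1 p2) (\<lambda>z. of_bool (e \<in> snd z))"
        unfolding p_def integral_map_pmf
        by (rule expectation_cong) (use p1 False in \<open>auto simp: E1_def\<close>)
      also have "\<dots> = marginal p2 e"
        by (rule expectation_pair_pmf_snd[where f = "\<lambda>J. of_bool (e \<in> J)"])
      finally show ?thesis using p2 that False by (simp add: E2_def)
    qed
    ultimately show ?thesis unfolding dominates_mixture_def by blast
  next
    case notight: False
    show ?thesis
    proof (cases "\<exists>e\<in>E. \<exists>f\<in>E. e \<noteq> f \<and> 0 < x e \<and> 0 < x f")
      case True
      then obtain e f where ef: "e \<in> E" "f \<in> E" "e \<noteq> f" "0 < x e" "0 < x f" by auto
      \<comment> \<open>The total is preserved, and positive edges are not loops; so singletons and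
        \<open>V\<close>, the only sets that can still be tight, stay tight.\<close>
      define d where "d = (\<lambda>g. of_bool (g = e) - of_bool (g = f) :: real)"
      define I where "I = {U. U \<subseteq> V \<and> U \<noteq> {}}"
      define a where "a = (\<lambda>U g. - of_bool (inside l r U g) :: real)"
      have suma: "(\<Sum>g\<in>E. a U g * z g) = - (\<Sum>g | g \<in> E \<and> inside l r U g. z g)" for U z
        using finE by (simp add: a_def sum_negf sum_of_bool_mult[symmetric])
      have sumd: "(\<Sum>g\<in>E. d g) = 0" using ef finE by (simp add: d_def sum_subtractf)
      have noloop: "l g \<noteq> r g" if "g \<in> E" "0 < x g" for g
      proof
        assume lr: "l g = r g"
        have "x g \<le> (\<Sum>e | e \<in> E \<and> inside l r {l g} e. x e)"
          using finE that nonneg lr by (intro member_le_sum) (auto simp: inside_def)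
        also have "\<dots> \<le> 0" using small[of "{l g}"] ends[OF that(1)] by (auto simp: inside_def)
        finally show False using that by simp
      qed
      show ?thesis
      proof (rule dominates_mixture_perturb[of E I x "\<lambda>U. 1 - real (card U)" a d])
        show "finite I" using finV by (simp add: I_def)
        show "1 - real (card U) \<le> (\<Sum>g\<in>E. a U g * x g)" if "U \<in> I" for U
          using small[of U] that unfolding suma by (simp add: I_def)
        show "(\<Sum>g\<in>E. a U g * d g) = 0"
          if U: "U \<in> I" "(\<Sum>g\<in>E. a U g * x g) = 1 - real (card U)" for U
        proof -
          have finU: "finite U" using U finV by (auto simp: I_def intro: finite_subset)
          consider "card U = 1" | "U = V"
          proof -
            have "\<not> (U \<subset> V \<and> 2 \<le> card U)" using notight U unfolding suma by auto
            moreover have "card U \<noteq> 0" using finU U by (auto simp: I_def)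
            ultimately show thesis using that U by (force simp: I_def)
          qed
          then show ?thesis
          proof cases
            case 1
            then obtain v where "U = {v}" by (auto simp: card_1_singleton_iff)
            then have "\<not> inside l r U e" "\<not> inside l r U f" using noloop[OF ef(1,4)] noloop[OF ef(2,5)] by (auto simp: inside_def)
            then show ?thesis by (auto simp: a_def d_def intro!: sum.neutral)
          next
            case 2
            then show ?thesis using sumd ends by (simp add: a_def sum_negf)
          qed
        qed
        show "\<exists>g\<in>E. d g \<noteq> 0" using ef by (auto simp: d_def intro!: bexI[of _ e])
        fix z k assume z: "\<And>g. g \<in> E \<Longrightarrow> 0 \<le> z g"
          "\<And>U. U \<in> I \<Longrightarrow> 1 - real (card U) \<le> (\<Sum>g\<in>E. a U g * z g)"
          "\<And>g. g \<in> E \<Longrightarrow> z g = x g + k * d g"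
          "card {g\<in>E. 0 < z g} + card {U\<in>I. 1 - real (card U) < (\<Sum>g\<in>E. a U g * z g)}
           < card {g\<in>E. 0 < x g} + card {U\<in>I. 1 - real (card U) < (\<Sum>g\<in>E. a U g * x g)}"
        have I_eq: "{U\<in>I. 1 - real (card U) < (\<Sum>g\<in>E. a U g * z g)} =
           {U. U \<subseteq> V \<and> U \<noteq> {} \<and> (\<Sum>e | e \<in> E \<and> inside l r U e. z e) < real (card U) - 1}" for z
          unfolding suma I_def by auto
        show "dominates_mixture E {S. connected_edges V l r S} z"
        proof (rule IH)
          show "(\<Sum>e | e \<in> E \<and> inside l r U e. z e) \<le> real (card U) - 1"
            if "U \<subseteq> V" "U \<noteq> {}" for U using z(2)[of U] that unfolding suma by (simp add: I_def)
          show "(\<Sum>e\<in>E. z e) = real (card V) - 1"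
            using total sumd by (simp add: z(3) sum.distrib sum_distrib_left[symmetric])
        qed (use z finV finE ne ends in \<open>auto simp: I_eq\<close>)
      qed (use finE nonneg ef in \<open>auto simp: d_def\<close>)
    next
      case False
      show ?thesis
      proof (cases "card V = 1")
        case True
        then obtain v where "V = {v}" by (auto simp: card_1_singleton_iff)
        then have "connected_edges V l r {}" by (auto simp: connected_edges_def)
        then show ?thesis unfolding dominates_mixture_def
          using nonneg by (intro exI[of _ "return_pmf {}"]) auto
      next
        case V1: False
        have "card V \<noteq> 0" using finV ne by simp
        then have V2: "real (card V) - 1 \<ge> 1" using V1 by simp
        have "\<exists>e\<in>E. 0 < x e"
        proof (rule ccontr)
          assume "\<not> ?thesis"
          then have "(\<Sum>e\<in>E. x e) \<le> 0" by (intro sum_nonpos) auto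
          then show False using V2 total by simp
        qed
        then obtain e where e: "e \<in> E" "0 < x e" by auto
        have "x g = 0" if "g \<in> E" "g \<noteq> e" for g using False that e nonneg[of g] by force
        then have "(\<Sum>g\<in>E. x g) = (\<Sum>g\<in>{e}. x g)"
          using e finE by (intro sum.mono_neutral_right) auto
        then have xe: "x e = real (card V) - 1" using total by simp
        let ?U = "{l e, r e}"
        have U: "?U \<subseteq> V" using ends[OF e(1)] by (auto simp: inside_def)
        have "x e \<le> (\<Sum>g | g \<in> E \<and> inside l r ?U g. x g)"
          using finE e nonneg by (intro member_le_sum) (auto simp: inside_def)
        also have "\<dots> \<le> real (card ?U) - 1" using small[OF U] by simp
        finally have "card V \<le> card ?U" using xe by simp
        then have "?U = V" using U finV by (simp add: card_seteq)
        then have "connected_edges V l r {e}" by (auto simp: connected_edges_def crosses_def)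
        then show ?thesis unfolding dominates_mixture_def
          using nonneg e xe V2 by (intro exI[of _ "return_pmf {e}"]) auto
      qed
    qed
  qed
qed

section \<open>The T-join polyhedron\<close>

text \<open>Loops count for no vertex, since \<open>crosses\<close> ignores them. Contraction can
  therefore keep the whole edge set and let the edges inside the contracted set become
  loops.\<close>

definition tjoin :: "'v set \<Rightarrow> ('e \<Rightarrow> 'v) \<Rightarrow> ('e \<Rightarrow> 'v) \<Rightarrow> 'v set \<Rightarrow> 'e set \<Rightarrow> bool" where
  "tjoin V l r T J \<longleftrightarrow> (\<forall>v\<in>V. odd (card {e\<in>J. crosses l r {v} e}) \<longleftrightarrow> v \<in> T)"

lemma odd_card_sym_diff:
  assumes "finite A" "finite B"
  shows "odd (card (sym_diff A B)) \<longleftrightarrow> odd (card A) \<noteq> odd (card B)"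
proof -
  have "card A = card (A - B) + card (A \<inter> B)" "card B = card (B - A) + card (A \<inter> B)"
    using assms by (metis card_Int_Diff add.commute Int_commute)+
  moreover have "card (sym_diff A B) = card (A - B) + card (B - A)"
    using assms by (intro card_Un_disjoint) auto
  ultimately show ?thesis by presburger
qed

text \<open>Add the degree parities over \<open>U\<close>: an edge joining two vertices of
  \<open>U\<close> is counted twice and cancels.\<close>

lemma tjoin_cut_parity:
  assumes "finite J" "tjoin V l r T J" "finite U" "U \<subseteq> V"
  shows "odd (card {e\<in>J. crosses l r U e}) \<longleftrightarrow> odd (card (U \<inter> T))"
  using assms(3,4)
proof (induction U rule: finite_induct)
  case empty
  then show ?case by (simp add: crosses_def)
next
  case (insert v U)
  have "{e\<in>J. crosses l r (insert v U) e} = sym_diff {e\<in>J. crosses l r {v} e} {e\<in>J. crosses l r U e}"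
    using insert by (auto simp: crosses_def)
  then have "odd (card {e\<in>J. crosses l r (insert v U) e})
      \<longleftrightarrow> odd (card {e\<in>J. crosses l r {v} e}) \<noteq> odd (card {e\<in>J. crosses l r U e})"
    using assms(1) by (simp add: odd_card_sym_diff)
  also have "\<dots> \<longleftrightarrow> (v \<in> T) \<noteq> odd (card (U \<inter> T))"
    using assms(2) insert by (simp add: tjoin_def)
  also have "\<dots> \<longleftrightarrow> odd (card (insert v U \<inter> T))"
    using insert by (auto simp: Int_insert_left)
  finally show ?case .
qed

section \<open>Contraction in the T-join polyhedron\<close>

definition cut_sum :: "'e set \<Rightarrow> ('e \<Rightarrow> 'v) \<Rightarrow> ('e \<Rightarrow> 'v) \<Rightarrow> ('e \<Rightarrow> real) \<Rightarrow> 'v set \<Rightarrow> real" where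
  "cut_sum E l r y U = (\<Sum>e | e \<in> E \<and> crosses l r U e. y e)"

text \<open>The parity at \<open>w\<close> is forced: the number of edges by which a
  \<open>T\<close>-join leaves \<open>W\<close> has the parity of
  \<open>card (W \<inter> T)\<close>.\<close>

definition shrink_set :: "'v set \<Rightarrow> 'v \<Rightarrow> 'v set \<Rightarrow> 'v set" where
  "shrink_set W w T = (T - W) \<union> (if odd (card (W \<inter> T)) then {w} else {})"

text \<open>The Edmonds-Johnson description of the vectors that dominate a convex combination of
  \<open>T\<close>-joins. The case \<open>U = V\<close> makes \<open>card T\<close> even, because no
  edge leaves \<open>V\<close>.\<close>

definition tjoin_feasible ::
    "'e set \<Rightarrow> 'v set \<Rightarrow> ('e \<Rightarrow> 'v) \<Rightarrow> ('e \<Rightarrow> 'v) \<Rightarrow> 'v set \<Rightarrow> ('e \<Rightarrow> real) \<Rightarrow> bool" where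
  "tjoin_feasible E V l r T y \<longleftrightarrow>
    (\<forall>e\<in>E. inside l r V e \<and> 0 \<le> y e) \<and> T \<subseteq> V \<and>
    (\<forall>U. U \<subseteq> V \<and> odd (card (U \<inter> T)) \<longrightarrow> 1 \<le> cut_sum E l r y U)"

lemma crosses_shrink:
  assumes "w \<in> W" "v \<notin> W"
  shows "crosses (shrink W w \<circ> l) (shrink W w \<circ> r) {v} e \<longleftrightarrow> crosses l r {v} e"
  using assms by (auto simp: crosses_def shrink_def)

text \<open>A cut of the contracted graph is a cut of the original graph that does not split
  \<open>W\<close>, and \<open>shrink_set\<close> preserves its parity.\<close>

lemma tjoin_feasible_shrink:
  assumes feas: "tjoin_feasible E V l r T y" and "finite V" "W \<subseteq> V" "w \<in> W"
  shows "tjoin_feasible E (insert w (V - W)) (shrink W w \<circ> l) (shrink W w \<circ> r) (shrink_set W w T) y"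
  unfolding tjoin_feasible_def
proof (intro conjI ballI allI impI)
  fix e assume "e \<in> E"
  then show "inside (shrink W w \<circ> l) (shrink W w \<circ> r) (insert w (V - W)) e" "0 \<le> y e"
    using feas by (auto simp: tjoin_feasible_def inside_def shrink_def)
next
  show "shrink_set W w T \<subseteq> insert w (V - W)"
    using feas by (auto simp: tjoin_feasible_def shrink_set_def)
next
  fix U assume U: "U \<subseteq> insert w (V - W) \<and> odd (card (U \<inter> shrink_set W w T))"
  define U' where "U' = (if w \<in> U then U \<union> W else U)"
  have fin: "finite U" "finite W" using U assms by (auto intro: finite_subset)
  have mem: "shrink W w v \<in> U \<longleftrightarrow> v \<in> U'" for v
    using U assms by (auto simp: shrink_def U'_def)
  have "odd (card (U' \<inter> T))"
  proof (cases "w \<in> U")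
    case True
    have disj: "(U - {w}) \<inter> W = {}" using U by auto
    have eq1: "U' \<inter> T = ((U - {w}) \<inter> T) \<union> (W \<inter> T)" using True assms by (auto simp: U'_def)
    have eq2: "U \<inter> shrink_set W w T = ((U - {w}) \<inter> T) \<union> (if odd (card (W \<inter> T)) then {w} else {})"
      using True disj assms by (auto simp: shrink_set_def split: if_splits)
    have "card (U' \<inter> T) = card ((U - {w}) \<inter> T) + card (W \<inter> T)"
      unfolding eq1 using fin disj by (intro card_Un_disjoint) auto
    moreover have "card (U \<inter> shrink_set W w T) = card ((U - {w}) \<inter> T) + (if odd (card (W \<inter> T)) then 1 else 0)"
      unfolding eq2 using fin by (subst card_Un_disjoint) auto
    ultimately show ?thesis using U by (auto split: if_splits)
  next
    case False
    then have "U \<inter> shrink_set W w T = U' \<inter> T" using U by (auto simp: shrink_set_def U'_def split: if_splits)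
    then show ?thesis using U by simp
  qed
  moreover have "U' \<subseteq> V" using U assms by (auto simp: U'_def)
  ultimately have "1 \<le> cut_sum E l r y U'" using feas by (auto simp: tjoin_feasible_def)
  then show "1 \<le> cut_sum E (shrink W w \<circ> l) (shrink W w \<circ> r) y U"
    by (simp add: cut_sum_def crosses_def mem)
qed

lemma tjoin_shrinkD:
  assumes "tjoin (insert w (V - W)) (shrink W w \<circ> l) (shrink W w \<circ> r) (shrink_set W w T) J" "w \<in> W"
  shows "v \<in> V - W \<Longrightarrow> odd (card {e\<in>J. crosses l r {v} e}) \<longleftrightarrow> v \<in> T"
    and "odd (card {e\<in>J. crosses l r W e}) \<longleftrightarrow> odd (card (W \<inter> T))"
proof -
  show "odd (card {e\<in>J. crosses l r {v} e}) \<longleftrightarrow> v \<in> T" if v: "v \<in> V - W"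
  proof -
    have "odd (card {e\<in>J. crosses (shrink W w \<circ> l) (shrink W w \<circ> r) {v} e}) \<longleftrightarrow> v \<in> shrink_set W w T"
      using assms(1) v by (simp only: tjoin_def) blast
    moreover have "v \<in> shrink_set W w T \<longleftrightarrow> v \<in> T" using v assms by (auto simp: shrink_set_def)
    ultimately show ?thesis using v assms(2) by (simp add: crosses_shrink)
  qed
  have "odd (card {e\<in>J. crosses (shrink W w \<circ> l) (shrink W w \<circ> r) {w} e}) \<longleftrightarrow> w \<in> shrink_set W w T"
    using assms(1) by (simp only: tjoin_def) blast
  moreover have "{e\<in>J. crosses (shrink W w \<circ> l) (shrink W w \<circ> r) {w} e} = {e\<in>J. crosses l r W e}"
    using assms(2) by (auto simp: crosses_def shrink_def)
  moreover have "w \<in> shrink_set W w T \<longleftrightarrow> odd (card (W \<inter> T))" using assms by (auto simp: shrink_set_def)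
  ultimately show "odd (card {e\<in>J. crosses l r W e}) \<longleftrightarrow> odd (card (W \<inter> T))" by simp
qed

text \<open>An odd intersection has at least one element, while the mean size is at most
  \<open>y\<close> summed over \<open>D\<close>, which is 1. So equality holds throughout: each set
  meets \<open>D\<close> once, and no marginal on \<open>D\<close> has slack.\<close>

lemma tight_cut_marginals:
  assumes finE: "finite E" and D: "D \<subseteq> E" and p: "set_pmf p \<subseteq> Pow E"
    and odd: "\<And>J. J \<in> set_pmf p \<Longrightarrow> odd (card (J \<inter> D))"
    and marg: "\<And>e. e \<in> E \<Longrightarrow> marginal p e \<le> y e" and tight: "(\<Sum>e\<in>D. y e) = 1"
  shows "\<And>J. J \<in> set_pmf p \<Longrightarrow> card (J \<inter> D) = 1" and "\<And>e. e \<in> D \<Longrightarrow> marginal p e = y e"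
proof -
  have finp: "finite (set_pmf p)" using p finE by (meson finite_Pow_iff finite_subset)
  have finD: "finite D" using D finE by (rule finite_subset)
  have ex: "measure_pmf.expectation p (\<lambda>J. real (card (J \<inter> D))) = (\<Sum>e\<in>D. marginal p e)"
  proof -
    have "real (card (J \<inter> D)) = (\<Sum>e\<in>D. of_bool (e \<in> J))" for J
      using finD by (simp add: sum_of_bool_eq Int_commute Int_def)
    then show ?thesis using finp
      by (simp add: Bochner_Integration.integral_sum integrable_measure_pmf_finite)
  qed
  have le: "(\<Sum>e\<in>D. marginal p e) \<le> (\<Sum>e\<in>D. y e)" using marg D by (intro sum_mono) auto
  have pos: "real (card (J \<inter> D)) \<ge> 1" if "J \<in> set_pmf p" for J
    using odd[OF that] by (cases "card (J \<inter> D)") auto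
  have ge: "measure_pmf.expectation p (\<lambda>J. real (card (J \<inter> D))) \<ge> 1"
    using expectation_mono_finite[OF finp, of "\<lambda>_. 1" "\<lambda>J. real (card (J \<inter> D))"] pos by simp
  show "card (J \<inter> D) = 1" if J: "J \<in> set_pmf p" for J
  proof (rule ccontr)
    assume "card (J \<inter> D) \<noteq> 1"
    then have "1 < card (J \<inter> D)" using odd[OF J] by (cases "card (J \<inter> D)") auto
    have "1 < measure_pmf.expectation p (\<lambda>J. real (card (J \<inter> D)))"
    proof -
      have "1 = (\<Sum>K\<in>set_pmf p. pmf p K * 1)" using finp by (simp add: sum_pmf_eq_1)
      also have "\<dots> < (\<Sum>K\<in>set_pmf p. pmf p K * real (card (K \<inter> D)))"
        using finp pos J \<open>1 < card (J \<inter> D)\<close>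
        by (intro sum_strict_mono_ex1 mult_left_mono ballI bexI[of _ J])
          (auto simp: pmf_positive)
      also have "\<dots> = measure_pmf.expectation p (\<lambda>J. real (card (J \<inter> D)))"
        using finp by (simp add: integral_measure_pmf[of "set_pmf p"])
      finally show ?thesis .
    qed
    then show False using ex le tight by simp
  qed
  show "marginal p e = y e" if e: "e \<in> D" for e
  proof (rule ccontr)
    assume "marginal p e \<noteq> y e"
    then have "marginal p e < y e" using marg D e by (metis less_eq_real_def subsetD)
    then have "(\<Sum>e\<in>D. marginal p e) < (\<Sum>e\<in>D. y e)"
      using finD e marg D by (intro sum_strict_mono_ex1) auto
    then show False using ex ge tight by simp
  qed
qed

lemma marginal_prob: "marginal p e = measure_pmf.prob p {J. e \<in> J}"
proof -
  have "(\<lambda>J. of_bool (e \<in> J)) = (indicator {J. e \<in> J} :: _ \<Rightarrow> real)" by (auto simp: indicator_def)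
  then show ?thesis by simp
qed

text \<open>Under both mixtures the single edge in \<open>D\<close> has the same distribution, so
  the two can be sampled jointly with the same edge.\<close>

lemma glue_coupling:
  assumes "set_pmf p \<subseteq> Pow E" "set_pmf q \<subseteq> Pow E"
    and p1: "\<And>J. J \<in> set_pmf p \<Longrightarrow> card (J \<inter> D) = 1" and q1: "\<And>J. J \<in> set_pmf q \<Longrightarrow> card (J \<inter> D) = 1"
    and eq: "\<And>e. e \<in> D \<Longrightarrow> marginal p e = marginal q e"
  shows "rel_pmf (\<lambda>I J. I \<inter> D = J \<inter> D) p q"
proof -
  \<comment> \<open>The law of \<open>J \<inter> D\<close> sits on singletons, where the marginals
    give it.\<close>
  have *: "pmf (map_pmf (\<lambda>J. J \<inter> D) p) A = (if \<exists>e\<in>D. A = {e} then marginal p (the_elem A) else 0)"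
    if "\<And>J. J \<in> set_pmf p \<Longrightarrow> card (J \<inter> D) = 1" for p A
  proof (cases "\<exists>e\<in>D. A = {e}")
    case True
    then obtain e where e: "e \<in> D" "A = {e}" by auto
    have "e \<in> J \<longleftrightarrow> J \<inter> D = {e}" if J: "J \<in> set_pmf p" for J
    proof -
      obtain f where "J \<inter> D = {f}" using \<open>\<And>J. J \<in> set_pmf p \<Longrightarrow> card (J \<inter> D) = 1\<close>[OF J]
        by (auto simp: card_1_singleton_iff)
      then show ?thesis using e by auto
    qed
    then have "measure_pmf.prob p {J. e \<in> J} = measure_pmf.prob p ((\<lambda>J. J \<inter> D) -` {{e}})"
      by (intro measure_pmf.finite_measure_eq_AE) (auto simp: AE_measure_pmf_iff)
    then show ?thesis using e by (simp add: pmf_map marginal_prob)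
  next
    case False
    have "A \<notin> (\<lambda>J. J \<inter> D) ` set_pmf p"
    proof
      assume "A \<in> (\<lambda>J. J \<inter> D) ` set_pmf p"
      then have "card A = 1" "A \<subseteq> D" using that by auto
      then show False using False by (auto simp: card_1_singleton_iff)
    qed
    then show ?thesis using False by (simp add: pmf_eq_0_set_pmf)
  qed
  have "map_pmf (\<lambda>J. J \<inter> D) p = map_pmf (\<lambda>J. J \<inter> D) q"
    by (rule pmf_eqI) (auto simp: *[OF p1] *[OF q1] eq)
  then show ?thesis
    unfolding pmf.rel_eq[symmetric] pmf.rel_map .
qed

text \<open>Contract either side of a tight odd cut and decompose both graphs. The cut is tight for
  both mixtures, so they can be coupled to agree on their unique cut edge; then a join on one side
  and a join on the other fit together.\<close>

lemma tjoin_glue: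
  assumes finV: "finite V" and finE: "finite E" and feas: "tjoin_feasible E V l r T y"
    and evenT: "even (card T)"
    and W: "W \<subseteq> V" "w \<in> W" "u \<in> V - W" "odd (card (W \<inter> T))" "cut_sum E l r y W = 1"
    and d1: "dominates_mixture E {J. tjoin (insert w (V - W)) (shrink W w \<circ> l) (shrink W w \<circ> r) (shrink_set W w T) J} y"
    and d2: "dominates_mixture E {J. tjoin (insert u W) (shrink (V - W) u \<circ> l) (shrink (V - W) u \<circ> r) (shrink_set (V - W) u T) J} y"
  shows "dominates_mixture E {J. tjoin V l r T J} y"
proof -
  define D where "D = {e\<in>E. crosses l r W e}"
  have ends: "inside l r V e" if "e \<in> E" for e using feas that by (auto simp: tjoin_feasible_def)
  have TV: "T \<subseteq> V" using feas by (auto simp: tjoin_feasible_def)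
  have compl: "crosses l r (V - W) e \<longleftrightarrow> crosses l r W e" if "e \<in> E" for e
    using ends[OF that] W by (auto simp: crosses_def inside_def)
  have VW: "V - (V - W) = W" using W by auto
  let ?F1 = "\<lambda>J. tjoin (insert w (V - W)) (shrink W w \<circ> l) (shrink W w \<circ> r) (shrink_set W w T) J"
  let ?F2 = "\<lambda>J. tjoin (insert u W) (shrink (V - W) u \<circ> l) (shrink (V - W) u \<circ> r) (shrink_set (V - W) u T) J"
  obtain p where p: "set_pmf p \<subseteq> {J. ?F1 J} \<inter> Pow E" "\<And>e. e \<in> E \<Longrightarrow> marginal p e \<le> y e"
    using d1 by (auto simp: dominates_mixture_def)
  obtain q where q: "set_pmf q \<subseteq> {J. ?F2 J} \<inter> Pow E" "\<And>e. e \<in> E \<Longrightarrow> marginal q e \<le> y e"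
    using d2 by (auto simp: dominates_mixture_def)
  have D: "D \<subseteq> E" "(\<Sum>e\<in>D. y e) = 1" using W by (auto simp: D_def cut_sum_def)
  have "card T = card ((V - W) \<inter> T) + card (W \<inter> T)"
  proof -
    have "T = ((V - W) \<inter> T) \<union> (W \<inter> T)" using TV W by auto
    then have "card T = card (((V - W) \<inter> T) \<union> (W \<inter> T))" by simp
    also have "\<dots> = card ((V - W) \<inter> T) + card (W \<inter> T)"
      using finV W by (intro card_Un_disjoint) (auto intro: finite_subset)
    finally show ?thesis .
  qed
  then have odd2: "odd (card ((V - W) \<inter> T))" using evenT W(4) by simp
  have JD: "J \<inter> D = {e\<in>J. crosses l r W e}" if "J \<subseteq> E" for J using that by (auto simp: D_def)
  have oddp: "odd (card (J \<inter> D))" if "J \<in> set_pmf p" for J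
  proof -
    have J: "J \<subseteq> E" "?F1 J" using p that by auto
    then show ?thesis using tjoin_shrinkD(2)[of w V W l r T J] W by (simp add: JD)
  qed
  have oddq: "odd (card (J \<inter> D))" if "J \<in> set_pmf q" for J
  proof -
    have J: "J \<subseteq> E" "?F2 J" using q that by auto
    have "{e\<in>J. crosses l r (V - W) e} = {e\<in>J. crosses l r W e}" using J compl by auto
    then show ?thesis using tjoin_shrinkD(2)[of u V "V - W" l r T J] J odd2 W by (simp add: VW JD)
  qed
  have "set_pmf p \<subseteq> Pow E" "set_pmf q \<subseteq> Pow E" using p q by auto
  note tp = tight_cut_marginals[OF finE D(1) \<open>set_pmf p \<subseteq> Pow E\<close> oddp p(2) D(2)]
    and tq = tight_cut_marginals[OF finE D(1) \<open>set_pmf q \<subseteq> Pow E\<close> oddq q(2) D(2)]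
  have "rel_pmf (\<lambda>I J. I \<inter> D = J \<inter> D) p q"
    by (rule glue_coupling[of p E q D]) (use p q tp tq in auto)
  then obtain pq where pq: "\<And>I J. (I, J) \<in> set_pmf pq \<Longrightarrow> I \<inter> D = J \<inter> D"
    "map_pmf fst pq = p" "map_pmf snd pq = q" by (cases rule: rel_pmf.cases) auto
  \<comment> \<open>Cut edges are taken from \<open>I\<close>, but \<open>I\<close> and
    \<open>J\<close> agree on them. Hence every vertex sees all its edges from one join:
    \<open>J\<close> within \<open>W\<close>, \<open>I\<close> outside.\<close>
  define G where "G = (\<lambda>(I, J). {e\<in>I. \<not> inside l r W e} \<union> {e\<in>J. inside l r W e})"
  have supp: "I \<in> set_pmf p" "J \<in> set_pmf q" if "(I, J) \<in> set_pmf pq" for I J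
    using that unfolding pq(2,3)[symmetric] by force+
  have "set_pmf (map_pmf G pq) \<subseteq> {J. tjoin V l r T J} \<inter> Pow E"
  proof
    fix K assume "K \<in> set_pmf (map_pmf G pq)"
    then obtain I J where IJ: "(I, J) \<in> set_pmf pq" "K = G (I, J)" by auto
    have I: "I \<subseteq> E" "?F1 I" using supp[OF IJ(1)] p by auto
    have J: "J \<subseteq> E" "?F2 J" using supp[OF IJ(1)] q by auto
    have same: "e \<in> I \<longleftrightarrow> e \<in> J" if "crosses l r W e" "e \<in> E" for e
      using pq(1)[OF IJ(1)] that by (auto simp: D_def)
    have "odd (card {e\<in>K. crosses l r {v} e}) \<longleftrightarrow> v \<in> T" if v: "v \<in> V" for v
    proof (cases "v \<in> W")
      case True
      have "{e\<in>K. crosses l r {v} e} = {e\<in>J. crosses l r {v} e}"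
        unfolding IJ(2) G_def using True I J same by (auto simp: crosses_def inside_def)
      then show ?thesis using tjoin_shrinkD(1)[of u V "V - W" l r T J v] J W True by (simp add: VW)
    next
      case False
      have "{e\<in>K. crosses l r {v} e} = {e\<in>I. crosses l r {v} e}"
        unfolding IJ(2) G_def using False by (auto simp: crosses_def inside_def)
      then show ?thesis using tjoin_shrinkD(1)[of w V W l r T I v] I W False v by simp
    qed
    then show "K \<in> {J. tjoin V l r T J} \<inter> Pow E"
      using I J by (auto simp: tjoin_def IJ(2) G_def)
  qed
  moreover have "marginal (map_pmf G pq) e \<le> y e" if e: "e \<in> E" for e
  proof (cases "inside l r W e")
    case True
    have "marginal (map_pmf G pq) e = measure_pmf.expectation pq (\<lambda>z. of_bool (e \<in> snd z))"
      unfolding integral_map_pmf by (rule expectation_cong) (use True in \<open>auto simp: G_def\<close>)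
    also have "\<dots> = marginal q e" unfolding pq(3)[symmetric] by simp
    finally show ?thesis using q e by simp
  next
    case False
    have "marginal (map_pmf G pq) e = measure_pmf.expectation pq (\<lambda>z. of_bool (e \<in> fst z))"
      unfolding integral_map_pmf by (rule expectation_cong) (use False in \<open>auto simp: G_def\<close>)
    also have "\<dots> = marginal p e" unfolding pq(2)[symmetric] by simp
    finally show ?thesis using p e by simp
  qed
  ultimately show ?thesis unfolding dominates_mixture_def by blast
qed

text \<open>If \<open>e\<close> is the only edge of positive value at a tight vertex \<open>v\<close>, it has value 1 and may
  be used always, so it can be contracted.\<close>

lemma tjoin_pendant:
  fixes V :: "'v set"
  assumes finV: "finite V" and finE: "finite E" and feas: "tjoin_feasible E V l r T y"
    and e: "e \<in> E" "crosses l r {v} e" and v: "v \<in> T" "cut_sum E l r y {v} = 1"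
    and only: "\<And>f. f \<in> E \<Longrightarrow> crosses l r {v} f \<Longrightarrow> f \<noteq> e \<Longrightarrow> y f = 0"
    and IH: "\<And>(V' :: 'v set) l' r' T'. finite V' \<Longrightarrow> card V' < card V \<Longrightarrow> tjoin_feasible E V' l' r' T' y \<Longrightarrow>
       dominates_mixture E {J. tjoin V' l' r' T' J} y"
  shows "dominates_mixture E {J. tjoin V l r T J} y"
proof -
  have inV: "inside l r V e" "T \<subseteq> V" using feas e by (auto simp: tjoin_feasible_def)
  obtain w where w: "w \<noteq> v" "{l e, r e} = {v, w}" "w \<in> V"
    using e inV by (auto simp: crosses_def inside_def)
  have vV: "v \<in> V" using v inV by auto
  let ?W = "{v, w}"
  let ?F = "\<lambda>J. tjoin (insert w (V - ?W)) (shrink ?W w \<circ> l) (shrink ?W w \<circ> r) (shrink_set ?W w T) J"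
  have "insert w (V - ?W) \<subset> V" using w vV by auto
  then have less: "card (insert w (V - ?W)) < card V" by (rule psubset_card_mono[OF finV])
  have feas': "tjoin_feasible E (insert w (V - ?W)) (shrink ?W w \<circ> l) (shrink ?W w \<circ> r) (shrink_set ?W w T) y"
    by (rule tjoin_feasible_shrink[OF feas finV]) (use w vV in auto)
  have "dominates_mixture E {J. ?F J} y" by (rule IH[OF _ less feas']) (simp add: finV)
  then obtain p where p: "set_pmf p \<subseteq> {J. ?F J} \<inter> Pow E" "\<And>e. e \<in> E \<Longrightarrow> marginal p e \<le> y e"
    by (auto simp: dominates_mixture_def)
  have ye: "y e = 1"
  proof -
    have "(\<Sum>f | f \<in> E \<and> crosses l r {v} f. y f) = (\<Sum>f\<in>{e}. y f)"
      using finE e only by (intro sum.mono_neutral_right) auto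
    then show ?thesis using v by (simp add: cut_sum_def)
  qed
  have avoid: "f \<notin> J" if "J \<in> set_pmf p" "f \<in> E" "y f = 0" for J f
  proof
    assume "f \<in> J"
    have "pmf p J \<le> measure_pmf.prob p {J. f \<in> J}"
      using \<open>f \<in> J\<close> by (simp add: measure_pmf_single[symmetric] measure_pmf.finite_measure_mono)
    then show False using p(2)[OF that(2)] that pmf_positive[OF that(1)] by (simp add: marginal_prob)
  qed
  have "set_pmf (map_pmf (insert e) p) \<subseteq> {J. tjoin V l r T J} \<inter> Pow E"
  proof
    fix K assume "K \<in> set_pmf (map_pmf (insert e) p)"
    then obtain J where J: "J \<in> set_pmf p" "K = insert e J" by auto
    have JE: "J \<subseteq> E" "?F J" using J p by auto
    have finJ: "finite J" using JE finE by (meson finite_subset)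
    have Kv: "{f\<in>K. crosses l r {v} f} = {e}"
      using avoid[OF J(1)] only JE e by (auto simp: J(2))
    \<comment> \<open>After the contraction \<open>e\<close> is a loop, so \<open>J\<close> may or
      may not contain it. In \<open>K\<close> it is present and raises the degree of
      \<open>w\<close> to one more than the cut of \<open>{v, w}\<close>.\<close>
    have "{f\<in>K. crosses l r {w} f} = insert e {f\<in>J. crosses l r ?W f}"
    proof -
      have "crosses l r {w} f \<longleftrightarrow> crosses l r ?W f" if "f \<in> J" "f \<noteq> e" for f
      proof -
        have "\<not> crosses l r {v} f" using avoid[OF J(1)] only JE that by auto
        then show ?thesis by (auto simp: crosses_def)
      qed
      moreover have "crosses l r {w} e" "\<not> crosses l r ?W e"
        using w by (auto simp: crosses_def doubleton_eq_iff)
      ultimately show ?thesis by (auto simp: J(2))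
    qed
    moreover have "\<not> crosses l r ?W e" using w(2) by (auto simp: crosses_def doubleton_eq_iff)
    ultimately have "card {f\<in>K. crosses l r {w} f} = Suc (card {f\<in>J. crosses l r ?W f})"
      using finJ by simp
    moreover have "odd (card {f\<in>J. crosses l r ?W f}) \<longleftrightarrow> odd (card (?W \<inter> T))"
      using tjoin_shrinkD(2)[of w V ?W l r T J] JE by simp
    moreover have "odd (card (?W \<inter> T)) \<longleftrightarrow> w \<notin> T" using v(1) w(1) by (auto simp: Int_insert_left)
    ultimately have Kw: "odd (card {f\<in>K. crosses l r {w} f}) \<longleftrightarrow> w \<in> T" by auto
    have "odd (card {f\<in>K. crosses l r {x} f}) \<longleftrightarrow> x \<in> T" if x: "x \<in> V" for x
    proof -
      consider "x = v" | "x = w" | "x \<in> V - ?W" using x by auto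
      then show ?thesis
      proof cases
        case 3
        then have "\<not> crosses l r {x} e" using w by (auto simp: crosses_def doubleton_eq_iff)
        then have "{f\<in>K. crosses l r {x} f} = {f\<in>J. crosses l r {x} f}" unfolding J(2) by auto
        then show ?thesis using tjoin_shrinkD(1)[of w V ?W l r T J x] JE 3 by simp
      qed (use Kv Kw v in auto)
    qed
    then show "K \<in> {J. tjoin V l r T J} \<inter> Pow E" using JE e by (auto simp: tjoin_def J(2))
  qed
  moreover have "marginal (map_pmf (insert e) p) f \<le> y f" if f: "f \<in> E" for f
  proof (cases "f = e")
    case True
    then show ?thesis using ye by simp
  next
    case False
    then show ?thesis using p f by simp
  qed
  ultimately show ?thesis unfolding dominates_mixture_def by blast
qed

lemma sum_of_bool_eq_single:
  "finite S \<Longrightarrow> (\<Sum>e\<in>S. of_bool (e = a) :: real) = of_bool (a \<in> S)"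
  by (cases "a \<in> S") (auto intro!: sum.neutral)

text \<open>Three consecutive vertices of a cycle of positive edges form a \<open>T\<close>-odd set of cut value at
  most 1. Such a set is trivial only when the cycle has length 4, where the signs can alternate.\<close>

lemma two_regular_kernel:
  assumes finV: "finite V" and finE: "finite E" and feas: "tjoin_feasible E V l r T y" and evenT: "even (card T)"
    and only_trivial: "\<And>W. W \<subseteq> V \<Longrightarrow> odd (card (W \<inter> T)) \<Longrightarrow> cut_sum E l r y W = 1 \<Longrightarrow>
       card W < 2 \<or> card (V - W) < 2"
    and H: "H = {e\<in>E. 0 < y e}" "H \<noteq> {}" and A: "A = {v\<in>T. cut_sum E l r y {v} = 1}"
    and deg: "\<And>v. v \<in> A \<Longrightarrow> card {e\<in>H. crosses l r {v} e} = 2"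
    and inA: "\<And>e. e \<in> H \<Longrightarrow> l e \<noteq> r e \<and> l e \<in> A \<and> r e \<in> A"
  shows "\<exists>d. (\<exists>e\<in>H. d e \<noteq> 0) \<and> (\<forall>v\<in>A. (\<Sum>e | e \<in> H \<and> crosses l r {v} e. d e) = (0::real))"
proof -
  have AT: "A \<subseteq> T" "T \<subseteq> V" using A feas by (auto simp: tjoin_feasible_def)
  have finH: "finite H" using H finE by simp
  define ends where "ends e = {l e, r e}" for e
  define dl where "dl v = {e\<in>H. crosses l r {v} e}" for v
  have dl: "e \<in> dl v \<longleftrightarrow> e \<in> H \<and> v \<in> ends e" for e v
    using inA[of e] by (auto simp: dl_def ends_def crosses_def)
  have other: "\<exists>w\<in>A. w \<noteq> v \<and> ends e = {v, w}" if "e \<in> dl v" for e v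
  proof (cases "v = l e")
    case True
    then show ?thesis using that inA[of e] dl[of e v] by (intro bexI[of _ "r e"]) (auto simp: ends_def)
  next
    case False
    then show ?thesis using that inA[of e] dl[of e v] by (intro bexI[of _ "l e"]) (auto simp: ends_def)
  qed
  have two: "\<exists>f. f \<noteq> e \<and> dl v = {e, f}" if "v \<in> A" "e \<in> dl v" for v e
    using deg[OF that(1)] that(2) unfolding dl_def[symmetric] by (auto simp: card_2_iff doubleton_eq_iff)
  have cut_H: "cut_sum E l r y U = (\<Sum>e | e \<in> H \<and> crosses l r U e. y e)" for U
    unfolding cut_sum_def
  proof (rule sum.mono_neutral_right)
    show "\<forall>i\<in>{e \<in> E. crosses l r U e} - {e \<in> H. crosses l r U e}. y i = 0"
      using feas H by (force simp: tjoin_feasible_def)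
  qed (use finE H in auto)
  have ysum: "(\<Sum>e\<in>dl v. y e) = 1" if "v \<in> A" for v
    using that A by (simp add: cut_H dl_def)
  have fin_dl: "finite (dl v)" for v using finH by (simp add: dl_def)
  obtain e1 where e1: "e1 \<in> H" using H by auto
  define v where "v = l e1"
  have v: "v \<in> A" "e1 \<in> dl v" using inA[OF e1] e1 dl by (auto simp: v_def ends_def)
  obtain u where u: "u \<in> A" "u \<noteq> v" "ends e1 = {v, u}" using other[OF v(2)] by auto
  obtain e2 where e2: "e2 \<noteq> e1" "dl v = {e1, e2}" using two[OF v] by auto
  have e2H: "e2 \<in> H" "e2 \<in> dl v" using e2 dl by auto
  obtain w where w: "w \<in> A" "w \<noteq> v" "ends e2 = {v, w}" using other[OF e2H(2)] by auto
  show ?thesis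
  proof (cases "u = w")
    case True
    \<comment> \<open>\<open>e1\<close> and \<open>e2\<close> are parallel, so shifting weight
      between them changes no degree.\<close>
    define d where "d = (\<lambda>e. of_bool (e = e1) - of_bool (e = e2) :: real)"
    have "(\<Sum>e\<in>dl x. d e) = 0" for x
      unfolding d_def sum_subtractf sum_of_bool_eq_single[OF fin_dl]
      using u w True e1 e2H by (simp add: dl)
    moreover have "d e1 \<noteq> 0" using e2 by (simp add: d_def)
    ultimately show ?thesis using e1 by (intro exI[of _ d] conjI bexI[of _ e1] ballI) (simp_all add: dl_def)
  next
    case uw: False
    have "e1 \<in> dl u" using e1 u dl by auto
    then obtain f where f: "f \<noteq> e1" "dl u = {e1, f}" using two[OF u(1)] by blast
    have "e2 \<in> dl w" using e2H w dl by auto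
    then obtain g where g: "g \<noteq> e2" "dl w = {e2, g}" using two[OF w(1)] by blast
    have fH: "f \<in> H" "u \<in> ends f" "f \<in> dl u" and gH: "g \<in> H" "w \<in> ends g" "g \<in> dl w"
      using f g dl by blast+
    have "f \<noteq> e2" using fH w u uw by auto
    have "g \<noteq> e1" using gH u w uw by auto
    let ?W = "{u, v, w}"
    have cardW: "card ?W = 3" using u w uw by simp
    have WT: "?W \<subseteq> T" "?W \<subseteq> V" "?W \<inter> T = ?W" using u v w AT by auto
    have "1 \<le> cut_sum E l r y ?W" using feas WT cardW by (simp add: tjoin_feasible_def del: insert_subset)
    have crossW: "e \<in> {f, g}" if "e \<in> H" "crosses l r ?W e" for e
    proof -
      have "e \<in> dl u \<union> dl v \<union> dl w" using that by (auto simp: crosses_def dl ends_def)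
      moreover have "\<not> crosses l r ?W e1" "\<not> crosses l r ?W e2"
        using u w by (auto simp: crosses_def ends_def doubleton_eq_iff)
      ultimately show ?thesis using that f g e2 by auto
    qed
    \<comment> \<open>Hence \<open>y f + y g = 2 - (y e1 + y e2) = 1\<close>.\<close>
    have yf: "y e1 + y f = 1" "y e1 + y e2 = 1" "y e2 + y g = 1"
      using ysum[OF u(1)] ysum[OF v(1)] ysum[OF w(1)] f g e2 by auto
    \<comment> \<open>If \<open>f\<close> and \<open>g\<close> coincided, the three edges would form
      a triangle that no positive edge leaves, although it is \<open>T\<close>-odd.\<close>
    have fg: "f \<noteq> g"
    proof
      assume "f = g"
      then have "ends f = {u, w}" using other[OF fH(3)] gH uw by auto
      then have "\<not> crosses l r ?W f" by (auto simp: ends_def crosses_def doubleton_eq_iff)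
      then have "cut_sum E l r y ?W = 0"
        unfolding cut_H using crossW \<open>f = g\<close> by (intro sum.neutral) blast
      then show False using \<open>1 \<le> cut_sum E l r y ?W\<close> by simp
    qed
    have "cut_sum E l r y ?W \<le> (\<Sum>e\<in>{f, g}. y e)"
      unfolding cut_H using crossW fH gH H by (intro sum_mono2) auto
    also have "\<dots> = 1" using fg yf by simp
    finally have "cut_sum E l r y ?W = 1" using \<open>1 \<le> cut_sum E l r y ?W\<close> by simp
    then have small: "card (V - ?W) < 2" using only_trivial[of ?W] WT cardW by simp
    \<comment> \<open>Three vertices cannot be all of \<open>V\<close>: then they would be all of
      \<open>T\<close>, whose size is even.\<close>
    have "V - ?W \<noteq> {}"
    proof
      assume "V - ?W = {}"
      then have "T = ?W" using WT AT by auto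
      then show False using evenT cardW by simp
    qed
    then have "card (V - ?W) = 1" using small finV by (simp add: card_gt_0_iff less_2_cases_iff)
    then obtain z where z: "V - ?W = {z}" by (auto simp: card_1_singleton_iff)
    have "f \<notin> dl v" "f \<notin> dl w" "g \<notin> dl u" "g \<notin> dl v"
      using e2 f g fg \<open>f \<noteq> e2\<close> \<open>g \<noteq> e1\<close> by auto
    then have avoid: "v \<notin> ends f" "w \<notin> ends f" "u \<notin> ends g" "v \<notin> ends g"
      using fH gH by (simp_all add: dl)
    obtain a where a: "a \<in> A" "a \<noteq> u" "ends f = {u, a}" using other[OF fH(3)] by blast
    obtain b where b: "b \<in> A" "b \<noteq> w" "ends g = {w, b}" using other[OF gH(3)] by blast
    have "a \<in> V - ?W" "b \<in> V - ?W" using a b avoid AT by auto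
    then have ab: "a = z" "b = z" unfolding z by auto
    have "ends f = {u, z}" "ends g = {w, z}" using a(3) b(3) ab by auto
    moreover have V: "V = {u, v, w, z}" using z WT by auto
    moreover have "z \<noteq> u" "z \<noteq> v" "z \<noteq> w" using z by auto
    \<comment> \<open>Alternating signs along the 4-cycle \<open>e1\<close>, \<open>e2\<close>,
      \<open>g\<close>, \<open>f\<close> cancel at each of its vertices \<open>v\<close>,
      \<open>w\<close>, \<open>z\<close>, \<open>u\<close>.\<close>
    define d where "d = (\<lambda>e. of_bool (e = e1) - of_bool (e = e2) + of_bool (e = g) - of_bool (e = f) :: real)"
    have "(\<Sum>e\<in>dl x. d e) = 0" if "x \<in> A" for x
    proof -
      have "(\<Sum>e\<in>dl x. d e) = of_bool (x \<in> ends e1) - of_bool (x \<in> ends e2) + of_bool (x \<in> ends g) - of_bool (x \<in> ends f)"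
        unfolding d_def sum_subtractf sum.distrib sum_of_bool_eq_single[OF fin_dl]
        using e1 e2H fH gH by (simp add: dl)
      moreover have "x \<in> {u, v, w, z}" using that AT V by auto
      ultimately show ?thesis
        using u w uw \<open>ends f = {u, z}\<close> \<open>ends g = {w, z}\<close> \<open>z \<noteq> u\<close> \<open>z \<noteq> v\<close> \<open>z \<noteq> w\<close> by auto
    qed
    moreover have "d e1 \<noteq> 0" using e2 f \<open>g \<noteq> e1\<close> by (simp add: d_def)
    ultimately show ?thesis using e1 by (intro exI[of _ d] conjI bexI[of _ e1] ballI) (simp_all add: dl_def)
  qed
qed

text \<open>Induction as for trees. A tight odd cut with at least two vertices on both sides is
  handled by gluing. Otherwise tight cuts are stars of the vertices in \<open>A\<close>, and a
  nonzero direction on the positive edges \<open>H\<close> that vanishes on these stars permits a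
  perturbation. If there is none, \<open>card H \<le> card A\<close>, and counting degrees leaves
  either a vertex with one positive edge, which is contracted, or a graph with all degrees 2. The
  latter has such a direction unless \<open>H\<close> and \<open>T\<close> are empty.\<close>

theorem tjoin_decomposition:
  fixes V :: "'v set" and E :: "'e set" and y :: "'e \<Rightarrow> real"
  assumes "finite V" "tjoin_feasible E V l r T y" and finE: "finite E"
  shows "dominates_mixture E {J. tjoin V l r T J} y"
  using assms(1,2)
proof (induction "(card V, card {e\<in>E. 0 < y e} + card {U. U \<subseteq> V \<and> odd (card (U \<inter> T)) \<and>
      1 < cut_sum E l r y U})" arbitrary: V l r T y
    rule: wf_induct_rule[OF wf_lex_prod[OF wf_less_than wf_less_than]])
  case (1 V l r T y)
  note IH = "1.hyps" and finV = "1.prems"(1) and feas = "1.prems"(2)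
  have ends: "inside l r V e" and nonneg: "0 \<le> y e" if "e \<in> E" for e
    using feas that by (auto simp: tjoin_feasible_def)
  have TV: "T \<subseteq> V" using feas by (auto simp: tjoin_feasible_def)
  have finT: "finite T" using TV finV by (rule finite_subset)
  have cut_ge: "1 \<le> cut_sum E l r y U" if "U \<subseteq> V" "odd (card (U \<inter> T))" for U
    using feas that by (auto simp: tjoin_feasible_def)
  have "cut_sum E l r y V = 0"
    unfolding cut_sum_def using ends by (intro sum.neutral) (auto simp: crosses_def inside_def)
  then have evenT: "even (card T)" using cut_ge[of V] TV by (auto simp: Int_absorb1)
  have small: "dominates_mixture E {J. tjoin V' l' r' T' J} y"
    if "finite V'" "card V' < card V" "tjoin_feasible E V' l' r' T' y"
    for V' :: "'v set" and l' r' T'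
    by (rule IH) (use that in auto)
  show ?case
  proof (cases "\<exists>W. W \<subseteq> V \<and> odd (card (W \<inter> T)) \<and> cut_sum E l r y W = 1 \<and> 2 \<le> card W \<and> 2 \<le> card (V - W)")
    case True
    then obtain W where W: "W \<subseteq> V" "odd (card (W \<inter> T))" "cut_sum E l r y W = 1" "2 \<le> card W" "2 \<le> card (V - W)"
      by auto
    obtain w u where wu: "w \<in> W" "u \<in> V - W" using W(4,5) by (metis card.empty ex_in_conv not_numeral_le_zero)
    have VW: "V - (V - W) = W" using W by auto
    have cards: "card V = card W + card (V - W)"
      using W finV by (metis card_Diff_subset card_mono finite_subset le_add_diff_inverse)
    show ?thesis
    proof (rule tjoin_glue[OF finV finE feas evenT W(1) wu W(2,3)])
      show "dominates_mixture E {J. tjoin (insert w (V - W)) (shrink W w \<circ> l) (shrink W w \<circ> r) (shrink_set W w T) J} y"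
        using finV feas W wu cards
        by (intro small tjoin_feasible_shrink) (auto simp: card_shrink)
      have "card (insert u W) < card V" "insert u (V - (V - W)) = insert u W" 
        using cards W VW wu finV by (auto simp: finite_subset card_insert_if)
      then show "dominates_mixture E {J. tjoin (insert u W) (shrink (V - W) u \<circ> l) (shrink (V - W) u \<circ> r) (shrink_set (V - W) u T) J} y"
        using tjoin_feasible_shrink[OF feas finV, of "V - W" u] wu finV W
        by (intro small) (auto intro: finite_subset)
    qed
  next
    case nontriv: False
    define A where "A = {v\<in>T. cut_sum E l r y {v} = 1}"
    define H where "H = {e\<in>E. 0 < y e}"
    have finA: "finite A" using finT by (simp add: A_def)
    have finH: "finite H" using finE by (simp add: H_def)
    show ?thesis
    proof (cases "\<exists>d. (\<exists>e\<in>H. d e \<noteq> 0) \<and> (\<forall>v\<in>A. (\<Sum>e | e \<in> H \<and> crosses l r {v} e. d e) = (0::real))")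
      case True
      then obtain d0 :: "'e \<Rightarrow> real" where "(\<exists>e\<in>H. d0 e \<noteq> 0) \<and> (\<forall>v\<in>A. (\<Sum>e | e \<in> H \<and> crosses l r {v} e. d0 e) = 0)"
        by (rule exE)
      then have d0: "\<exists>e\<in>H. d0 e \<noteq> 0" "\<And>v. v \<in> A \<Longrightarrow> (\<Sum>e | e \<in> H \<and> crosses l r {v} e. d0 e) = 0"
        by simp_all
      \<comment> \<open>Extended by 0, so that edges of value 0 do not move.\<close>
      define d where "d = (\<lambda>e. if e \<in> H then d0 e else 0)"
      have cut_d: "cut_sum E l r d {v} = 0" if "v \<in> A" for v
      proof -
        have "cut_sum E l r d {v} = (\<Sum>e | e \<in> H \<and> crosses l r {v} e. d0 e)"
          unfolding cut_sum_def using finE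
          by (intro sum.mono_neutral_cong_right) (auto simp: d_def H_def)
        then show ?thesis using d0(2)[OF that] by simp
      qed
      define I where "I = {U. U \<subseteq> V \<and> odd (card (U \<inter> T))}"
      define a where "a = (\<lambda>U e. of_bool (crosses l r U e) :: real)"
      have suma: "(\<Sum>e\<in>E. a U e * z e) = cut_sum E l r z U" for U z
        unfolding a_def cut_sum_def by (rule sum_of_bool_mult[OF finE])
      show ?thesis
      proof (rule dominates_mixture_perturb[of E I y "\<lambda>_. 1" a d])
        show "finite I" using finV by (simp add: I_def)
        show "1 \<le> (\<Sum>e\<in>E. a U e * y e)" if "U \<in> I" for U
          using cut_ge that unfolding suma by (simp add: I_def)
        show "(\<Sum>e\<in>E. a U e * d e) = 0" if U: "U \<in> I" "(\<Sum>e\<in>E. a U e * y e) = 1" for U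
        proof -
          have U': "U \<subseteq> V" "odd (card (U \<inter> T))" "cut_sum E l r y U = 1" using U by (auto simp: I_def suma)
          have finU: "finite U" using U' finV by (auto intro: finite_subset)
          \<comment> \<open>A trivial tight cut is the star of one vertex. If that vertex is the
            complement of \<open>U\<close>, evenness of \<open>card T\<close> places it in
            \<open>T\<close>.\<close>
          consider "card U < 2" | "card (V - U) < 2" using nontriv U' by force
          then obtain v where v: "v \<in> T" "\<And>e. e \<in> E \<Longrightarrow> crosses l r U e \<longleftrightarrow> crosses l r {v} e"
          proof cases
            case 1
            moreover have "U \<noteq> {}" using U' by auto
            ultimately have "card U = 1" using finU by (simp add: card_gt_0_iff less_2_cases_iff)
            then obtain v where "U = {v}" by (auto simp: card_1_singleton_iff)
            then show ?thesis using that[of v] U' by (cases "v \<in> T") auto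
          next
            case 2
            moreover have "V - U \<noteq> {}"
            proof
              assume "V - U = {}"
              then have "U \<inter> T = T" using TV by auto
              then show False using U' evenT by simp
            qed
            ultimately have "card (V - U) = 1" using finV by (simp add: card_gt_0_iff less_2_cases_iff)
            then obtain v where v: "V - U = {v}" by (auto simp: card_1_singleton_iff)
            have "v \<in> T"
            proof (rule ccontr)
              assume "v \<notin> T"
              then have "U \<inter> T = T" using v TV by auto
              then show False using U' evenT by simp
            qed
            moreover have "crosses l r U e \<longleftrightarrow> crosses l r {v} e" if "e \<in> E" for e
            proof -
              have "x \<in> U \<longleftrightarrow> x \<noteq> v" if "x \<in> V" for x using v that by auto
              then show ?thesis using ends[OF that] by (auto simp: crosses_def inside_def)
            qed
            ultimately show ?thesis using that by blast
          qed
          have eq: "cut_sum E l r z U = cut_sum E l r z {v}" for z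
            unfolding cut_sum_def using v by (intro sum.cong) auto
          then have "v \<in> A" using v U' by (simp add: A_def)
          then show ?thesis using cut_d by (simp add: suma eq)
        qed
        show "\<exists>e\<in>E. d e \<noteq> 0" using d0 by (auto simp: d_def H_def)
        fix z k assume z: "\<And>e. e \<in> E \<Longrightarrow> 0 \<le> z e"
          "\<And>U. U \<in> I \<Longrightarrow> 1 \<le> (\<Sum>e\<in>E. a U e * z e)"
          "card {e\<in>E. 0 < z e} + card {U\<in>I. 1 < (\<Sum>e\<in>E. a U e * z e)}
           < card {e\<in>E. 0 < y e} + card {U\<in>I. 1 < (\<Sum>e\<in>E. a U e * y e)}"
        have I_eq: "{U\<in>I. 1 < (\<Sum>e\<in>E. a U e * z e)} =
           {U. U \<subseteq> V \<and> odd (card (U \<inter> T)) \<and> 1 < cut_sum E l r z U}" for z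
          unfolding suma I_def by auto
        show "dominates_mixture E {J. tjoin V l r T J} z"
        proof (rule IH)
          show "tjoin_feasible E V l r T z"
            using z(1,2) ends TV by (auto simp: tjoin_feasible_def suma I_def)
        qed (use z(3) finV in \<open>auto simp: I_eq\<close>)
      qed (use finE nonneg in \<open>auto simp: d_def H_def\<close>)
    next
      case nokernel: False
      \<comment> \<open>Otherwise the stars give fewer equations than there are unknowns.\<close>
      have card_HA: "card H \<le> card A"
      proof (rule ccontr)
        assume "\<not> ?thesis"
        then obtain d :: "'e \<Rightarrow> real" where "\<exists>e\<in>H. d e \<noteq> 0"
          "\<forall>v\<in>A. (\<Sum>e\<in>H. of_bool (crosses l r {v} e) * d e) = 0"
          using homogeneous_system_nontrivial[OF finA finH, of "\<lambda>v e. of_bool (crosses l r {v} e)"] by auto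
        then show False using nokernel by (simp only: sum_of_bool_mult[OF finH]) blast
      qed
      show ?thesis
      proof (cases "\<exists>v\<in>A. card {e\<in>H. crosses l r {v} e} < 2")
        case True
        then obtain v where v: "v \<in> A" "card {e\<in>H. crosses l r {v} e} < 2" by auto
        have "{e\<in>H. crosses l r {v} e} \<noteq> {}"
        proof
          assume "{e\<in>H. crosses l r {v} e} = {}"
          then have "y e = 0" if "e \<in> E" "crosses l r {v} e" for e
            using that nonneg[of e] by (force simp: H_def)
          then have "cut_sum E l r y {v} = 0" by (simp add: cut_sum_def)
          then show False using v by (simp add: A_def)
        qed
        moreover have "finite {e\<in>H. crosses l r {v} e}" using finH by simp
        ultimately have "card {e\<in>H. crosses l r {v} e} > 0" unfolding card_gt_0_iff by blast
        then have "card {e\<in>H. crosses l r {v} e} = 1" using v(2) by linarith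
        then obtain e where e: "{e\<in>H. crosses l r {v} e} = {e}" by (auto simp: card_1_singleton_iff)
        have e': "e \<in> E" "crosses l r {v} e" using e by (auto simp: H_def)
        show ?thesis
        proof (rule tjoin_pendant[OF finV finE feas e'])
          show "y f = 0" if "f \<in> E" "crosses l r {v} f" "f \<noteq> e" for f
            using that e nonneg[of f] by (force simp: H_def)
        qed (use v small in \<open>auto simp: A_def\<close>)
      next
        case False
        \<comment> \<open>Double counting: twice \<open>card A\<close> is at most the degree sum
          over \<open>A\<close>, which is at most twice \<open>card H\<close>, hence at most twice
          \<open>card A\<close>. So all degrees are 2, and every edge of \<open>H\<close> has two
          distinct ends in \<open>A\<close>.\<close>
        have cnt: "(\<Sum>v\<in>A. card {e\<in>H. crosses l r {v} e}) = (\<Sum>e\<in>H. card {v\<in>A. crosses l r {v} e})"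
          using finA finH by (intro sum_multicount_gen) auto
        have le2: "card {v\<in>A. crosses l r {v} e} \<le> 2" for e
        proof -
          have "card {v\<in>A. crosses l r {v} e} \<le> card {l e, r e}"
            by (intro card_mono) (auto simp: crosses_def)
          also have "\<dots> \<le> 2" by (simp add: card_insert_if)
          finally show ?thesis .
        qed
        have ge2: "2 \<le> card {e\<in>H. crosses l r {v} e}" if "v \<in> A" for v using False that by force
        have 1: "(\<Sum>v\<in>A. 2) \<le> (\<Sum>v\<in>A. card {e\<in>H. crosses l r {v} e})"
          using ge2 by (intro sum_mono)
        have 2: "(\<Sum>e\<in>H. card {v\<in>A. crosses l r {v} e}) \<le> (\<Sum>e\<in>H. 2)"
          using le2 by (intro sum_mono)
        have eqA: "(\<Sum>v\<in>A. 2) = (\<Sum>v\<in>A. card {e\<in>H. crosses l r {v} e})"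
          and eqH: "(\<Sum>e\<in>H. card {v\<in>A. crosses l r {v} e}) = (\<Sum>e\<in>H. 2)"
          using 1 2 cnt card_HA by auto
        have deg: "card {e\<in>H. crosses l r {v} e} = 2" if "v \<in> A" for v
          using sum_mono_inv[OF eqA ge2 that finA] by simp
        have inA: "l e \<noteq> r e \<and> l e \<in> A \<and> r e \<in> A" if e: "e \<in> H" for e
        proof -
          have "card {v\<in>A. crosses l r {v} e} = 2" using sum_mono_inv[OF eqH le2 e finH] .
          then obtain a b where ab: "{v\<in>A. crosses l r {v} e} = {a, b}" "a \<noteq> b" by (auto simp: card_2_iff)
          have "a \<in> A" "b \<in> A" "crosses l r {a} e" "crosses l r {b} e" using ab(1) by blast+
          then show ?thesis using ab(2) by (auto simp: crosses_def)
        qed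
        have "H = {}"
        proof (rule ccontr)
          assume "H \<noteq> {}"
          have "\<exists>d. (\<exists>e\<in>H. d e \<noteq> 0) \<and> (\<forall>v\<in>A. (\<Sum>e | e \<in> H \<and> crosses l r {v} e. d e) = (0::real))"
            by (rule two_regular_kernel[OF finV finE feas evenT _ H_def \<open>H \<noteq> {}\<close> A_def deg inA])
              (use nontriv in force)
          then show False using nokernel by simp
        qed
        then have y0: "y e = 0" if "e \<in> E" for e using that nonneg[of e] by (force simp: H_def)
        have "T = {}"
        proof (rule ccontr)
          assume "T \<noteq> {}"
          then obtain v where v: "v \<in> T" by auto
          have "1 \<le> cut_sum E l r y {v}" using cut_ge[of "{v}"] v TV by auto
          then show False using y0 by (simp add: cut_sum_def)
        qed
        then have "tjoin V l r T {}" by (simp add: tjoin_def)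
        then show ?thesis unfolding dominates_mixture_def
          using nonneg by (intro exI[of _ "return_pmf {}"]) auto
      qed
    qed
  qed
qed

section \<open>Narrow cuts and tours\<close>

lemma cut_sum_of_bool: "finite E \<Longrightarrow> cut_sum E l r z U = (\<Sum>e\<in>E. of_bool (crosses l r U e) * z e)"
  by (simp only: cut_sum_def sum_of_bool_mult)

text \<open>No edge joins \<open>A\<close> to \<open>B\<close> or \<open>L\<close> to
  \<open>R\<close>, so every edge between different parts leaves \<open>L\<close> or
  \<open>R\<close>, and each of these has at most one leaving edge. Merging the parts to points
  gives too few edges for a connected graph: at most two for four parts, one less for each of
  \<open>L\<close> and \<open>R\<close> that is empty.\<close>

lemma connected_edges_four_parts:
  assumes conn: "connected_edges V l r S" and ends: "\<And>e. e \<in> S \<Longrightarrow> inside l r V e"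
    and V: "V = L \<union> A \<union> B \<union> R" "L \<inter> A = {}" "L \<inter> B = {}" "L \<inter> R = {}" "A \<inter> B = {}" "A \<inter> R = {}" "B \<inter> R = {}"
    and ne: "A \<noteq> {}" "B \<noteq> {}"
    and AB: "\<And>e. e \<in> S \<Longrightarrow> crosses l r A e \<Longrightarrow> \<not> crosses l r B e"
    and LR: "\<And>e. e \<in> S \<Longrightarrow> crosses l r L e \<Longrightarrow> \<not> crosses l r R e"
    and L1: "\<And>e f. e \<in> S \<Longrightarrow> f \<in> S \<Longrightarrow> crosses l r L e \<Longrightarrow> crosses l r L f \<Longrightarrow> e = f"
    and R1: "\<And>e f. e \<in> S \<Longrightarrow> f \<in> S \<Longrightarrow> crosses l r R e \<Longrightarrow> crosses l r R f \<Longrightarrow> e = f"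
  shows False
proof -
  have ex: "\<exists>e\<in>S. crosses l r U e" if "U \<subseteq> V" "U \<noteq> {}" "U \<noteq> V" for U
    using conn that unfolding connected_edges_def by blast
  \<comment> \<open>Each end lies in exactly one part, so an edge crosses either none or two of the
    four.\<close>
  have parity: "crosses l r A e \<noteq> crosses l r B e \<longleftrightarrow> crosses l r L e \<noteq> crosses l r R e" if "e \<in> S" for e
  proof -
    have "(v \<in> A) \<noteq> (v \<in> B) \<longleftrightarrow> \<not> (v \<in> L) \<noteq> (v \<in> R)" if "v \<in> V" for v
      using that unfolding V(1) using V(2-) by blast
    then have "(l e \<in> A) \<noteq> (l e \<in> B) \<longleftrightarrow> \<not> (l e \<in> L) \<noteq> (l e \<in> R)"
      "(r e \<in> A) \<noteq> (r e \<in> B) \<longleftrightarrow> \<not> (r e \<in> L) \<noteq> (r e \<in> R)"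
      using ends[OF that] by (simp_all add: inside_def)
    then show ?thesis unfolding crosses_def by argo
  qed
  have proper: "L \<union> A \<subseteq> V" "L \<union> A \<noteq> {}" "L \<union> A \<noteq> V" "L \<union> B \<subseteq> V" "L \<union> B \<noteq> {}" "L \<union> B \<noteq> V"
    "A \<subseteq> V" "A \<noteq> V" "B \<subseteq> V" "B \<noteq> V"
    unfolding V(1) using V(2-) ne by blast+
  obtain f where f: "f \<in> S" "crosses l r A f" using ex[OF proper(7) ne(1) proper(8)] by blast
  obtain g where g: "g \<in> S" "crosses l r B g" using ex[OF proper(9) ne(2) proper(10)] by blast
  have fg: "f \<noteq> g" "\<not> crosses l r B f" "\<not> crosses l r A g" using f g AB by auto
  have cross_Un: "crosses l r (P \<union> Q) e \<longleftrightarrow> crosses l r P e \<noteq> crosses l r Q e" if "P \<inter> Q = {}" for P Q e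
    using that by (auto simp: crosses_def)
  show False
  proof (cases "crosses l r L f")
    case True
    then have "\<not> crosses l r L g" using L1 f(1) g(1) fg(1) by blast
    then have Rg: "crosses l r R g" using parity[OF g(1)] g(2) fg(3) by simp
    obtain h where h: "h \<in> S" "crosses l r (L \<union> A) h" using ex[OF proper(1-3)] by blast
    then have LA: "crosses l r L h \<noteq> crosses l r A h" using cross_Un[OF V(2)] by simp
    show False
    proof (cases "crosses l r L h")
      case Lh: True
      then have "h = f" using L1 True h(1) f(1) by blast
      then show False using LA Lh f(2) by simp
    next
      case False
      then have "crosses l r A h" "\<not> crosses l r B h" using LA AB h(1) by auto
      then have "crosses l r R h" using parity[OF h(1)] False by simp
      then have "h = g" using R1 Rg h(1) g(1) by blast
      then show False using \<open>crosses l r A h\<close> fg(3) by simp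
    qed
  next
    case False
    then have Rf: "crosses l r R f" using parity[OF f(1)] f(2) fg(2) by simp
    then have "\<not> crosses l r R g" using R1 f(1) g(1) fg(1) by blast
    then have Lg: "crosses l r L g" using parity[OF g(1)] g(2) fg(3) by simp
    obtain h where h: "h \<in> S" "crosses l r (L \<union> B) h" using ex[OF proper(4-6)] by blast
    then have LB: "crosses l r L h \<noteq> crosses l r B h" using cross_Un[OF V(3)] by simp
    show False
    proof (cases "crosses l r L h")
      case Lh: True
      then have "h = g" using L1 Lg h(1) g(1) by blast
      then show False using LB Lh g(2) by simp
    next
      case False
      then have "crosses l r B h" "\<not> crosses l r A h" using LB AB h(1) by auto
      then have "crosses l r R h" using parity[OF h(1)] False by simp
      then have "h = f" using R1 Rf h(1) f(1) by blast
      then show False using \<open>crosses l r B h\<close> fg(2) by simp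
    qed
  qed
qed

text \<open>A level between two neighbouring lonely cuts induces a connected part of
  \<open>S\<close>: if \<open>X\<close> split it uncrossed, the two halves with the parts below and
  above would be the four parts excluded before.\<close>

lemma level_uncut:
  assumes conn: "connected_edges V l r S" and ends: "\<And>e. e \<in> S \<Longrightarrow> inside l r V e"
    and LK: "L \<subseteq> K" "K \<subseteq> V"
    and LKcr: "\<And>e. e \<in> S \<Longrightarrow> crosses l r L e \<Longrightarrow> \<not> crosses l r K e"
    and L1: "\<And>e f. e \<in> S \<Longrightarrow> f \<in> S \<Longrightarrow> crosses l r L e \<Longrightarrow> crosses l r L f \<Longrightarrow> e = f"
    and K1: "\<And>e f. e \<in> S \<Longrightarrow> f \<in> S \<Longrightarrow> crosses l r K e \<Longrightarrow> crosses l r K f \<Longrightarrow> e = f"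
    and X: "\<And>e. e \<in> S \<Longrightarrow> inside l r (K - L) e \<Longrightarrow> \<not> crosses l r X e"
  shows "(K - L) \<inter> X = {} \<or> K - L \<subseteq> X"
proof (rule ccontr)
  assume neg: "\<not> ?thesis"
  have R: "crosses l r (V - K) e \<longleftrightarrow> crosses l r K e" if "e \<in> S" for e
    using ends[OF that] by (auto simp: crosses_def inside_def)
  show False
  proof (rule connected_edges_four_parts[OF conn ends, of L "(K - L) \<inter> X" "K - L - X" "V - K"])
    show "\<not> crosses l r (K - L - X) e" if "e \<in> S" "crosses l r ((K - L) \<inter> X) e" for e
      using X[OF that(1)] that(2) by (auto simp: crosses_def inside_def)
  qed (use neg LK LKcr L1 K1 R in auto)
qed

section \<open>The path LP on abstract edges and its narrow cuts\<close>

locale st_path_lp =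
  fixes V :: "'v set" and E :: "'e set" and l r :: "'e \<Rightarrow> 'v" and s t :: 'v and x :: "'e \<Rightarrow> real"
  assumes finV: "finite V" and finE: "finite E"
    and ends: "e \<in> E \<Longrightarrow> inside l r V e" and no_loop: "e \<in> E \<Longrightarrow> l e \<noteq> r e"
    and st: "s \<in> V" "t \<in> V" "s \<noteq> t"
    and nonneg: "e \<in> E \<Longrightarrow> 0 \<le> x e"
    and degree: "v \<in> V \<Longrightarrow> cut_sum E l r x {v} = (if v \<in> {s, t} then 1 else 2)"
    and cuts: "U \<subseteq> V \<Longrightarrow> U \<noteq> {} \<Longrightarrow> U \<noteq> V \<Longrightarrow>
      (if (s \<in> U) \<noteq> (t \<in> U) then 1 else 2) \<le> cut_sum E l r x U"
begin

text \<open>Cuts of value below 2 separate \<open>s\<close> from \<open>t\<close>, so each is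
  represented by its side containing \<open>s\<close>. Working with sides makes inclusion
  available.\<close>

definition narrow :: "'v set set" where
  "narrow = {U. U \<subseteq> V \<and> s \<in> U \<and> t \<notin> U \<and> cut_sum E l r x U < 2}"

lemma finite_narrow: "finite narrow"
  using finV by (auto simp: narrow_def intro: finite_subset[of _ "Pow V"])

text \<open>Add the degree equations over \<open>U\<close>: edges inside count twice, edges leaving
  count once.\<close>

lemma sum_inside:
  assumes "U \<subseteq> V"
  shows "2 * (\<Sum>e | e \<in> E \<and> inside l r U e. x e)
    = 2 * real (card U) - of_bool (s \<in> U) - of_bool (t \<in> U) - cut_sum E l r x U"
proof -
  have finU: "finite U" using assms finV by (rule finite_subset)
  have "(\<Sum>v\<in>U. cut_sum E l r x {v}) = (\<Sum>v\<in>U. 2 - of_bool (v = s) - of_bool (v = t))"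
    using assms degree st by (intro sum.cong) auto
  also have "\<dots> = 2 * real (card U) - of_bool (s \<in> U) - of_bool (t \<in> U)"
    unfolding sum_subtractf sum_of_bool_eq_single[OF finU] by simp
  finally have demand: "(\<Sum>v\<in>U. cut_sum E l r x {v}) = \<dots>" .
  have "(\<Sum>v\<in>U. cut_sum E l r x {v}) = (\<Sum>e\<in>E. (\<Sum>v\<in>U. of_bool (crosses l r {v} e)) * x e)"
    unfolding cut_sum_of_bool[OF finE] sum_distrib_right by (rule sum.swap)
  also have "\<dots> = (\<Sum>e\<in>E. 2 * (of_bool (inside l r U e) * x e) + of_bool (crosses l r U e) * x e)"
  proof (intro sum.cong refl)
    fix e assume e: "e \<in> E"
    have "(\<Sum>v\<in>U. of_bool (crosses l r {v} e)) = (\<Sum>v\<in>U. of_bool (v = l e) + of_bool (v = r e) :: real)"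
      using no_loop[OF e] by (intro sum.cong) (auto simp: crosses_def)
    also have "\<dots> = of_bool (l e \<in> U) + of_bool (r e \<in> U)"
      unfolding sum.distrib sum_of_bool_eq_single[OF finU] by simp
    finally have "(\<Sum>v\<in>U. of_bool (crosses l r {v} e) :: real) = \<dots>" .
    then show "(\<Sum>v\<in>U. of_bool (crosses l r {v} e)) * x e
      = 2 * (of_bool (inside l r U e) * x e) + of_bool (crosses l r U e) * x e"
      by (auto simp: inside_def crosses_def)
  qed
  also have "\<dots> = 2 * (\<Sum>e | e \<in> E \<and> inside l r U e. x e) + cut_sum E l r x U"
    unfolding cut_sum_of_bool[OF finE] sum.distrib sum_distrib_left[symmetric] sum_of_bool_mult[OF finE] ..
  finally show ?thesis using demand by simp
qed

lemma cut_sum_V: "cut_sum E l r z V = 0"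
  unfolding cut_sum_def using ends by (intro sum.neutral) (auto simp: crosses_def inside_def)

text \<open>By \<open>sum_inside\<close>, the cut bound 1 for a separating set and 2 for any other
  yields at most \<open>card U - 1\<close> inside, with equality for \<open>V\<close>, whose cut is
  empty.\<close>

lemma spanning_trees: "dominates_mixture E {S. connected_edges V l r S} x"
proof (rule spanning_tree_decomposition)
  show "(\<Sum>e | e \<in> E \<and> inside l r U e. x e) \<le> real (card U) - 1" if "U \<subseteq> V" "U \<noteq> {}" for U
  proof (cases "U = V")
    case True
    then show ?thesis using sum_inside[of V] cut_sum_V[of x] st by simp
  next
    case False
    then show ?thesis using sum_inside[OF that(1)] cuts[OF that False] by (cases "s \<in> U"; cases "t \<in> U") auto
  qed
  have "(\<Sum>e\<in>E. x e) = (\<Sum>e | e \<in> E \<and> inside l r V e. x e)" using ends by (intro sum.cong) auto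
  then show "(\<Sum>e\<in>E. x e) = real (card V) - 1" using sum_inside[of V] cut_sum_V[of x] st by simp
qed (use finV finE ends nonneg st in auto)

lemma cut_sum_diff:
  "cut_sum E l r x (U - W) + cut_sum E l r x (W - U) \<le> cut_sum E l r x U + cut_sum E l r x W"
  unfolding cut_sum_of_bool[OF finE] sum.distrib[symmetric]
  using nonneg by (intro sum_mono) (auto simp: crosses_def)

text \<open>If neither contains the other, both differences are nonempty and avoid \<open>s\<close>
  and \<open>t\<close>, so their cuts have value at least 2. Posimodularity bounds the sum of these
  values by that of two narrow cuts, which is below 4.\<close>

lemma narrow_chain:
  assumes "U \<in> narrow" "W \<in> narrow"
  shows "U \<subseteq> W \<or> W \<subseteq> U"
proof (rule ccontr)
  assume "\<not> ?thesis"
  then have "2 \<le> cut_sum E l r x (U - W)" "2 \<le> cut_sum E l r x (W - U)"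
    using cuts[of "U - W"] cuts[of "W - U"] assms st by (auto simp: narrow_def split: if_splits)
  then show False using cut_sum_diff[of U W] assms by (auto simp: narrow_def)
qed

text \<open>For nested sides with the same cut edges, no edge would leave their difference, which
  violates its cut constraint. This lets a bound on the number of narrow edge sets bound the number
  of sides.\<close>

lemma narrow_determined_by_edges:
  assumes U: "U \<in> narrow" and W: "W \<in> narrow"
    and eq: "{e\<in>E. crosses l r U e} = {e\<in>E. crosses l r W e}"
  shows "U = W"
proof -
  have no: "\<not> Z \<subset> Z'" if "Z \<in> narrow" "Z' \<in> narrow" "{e\<in>E. crosses l r Z e} = {e\<in>E. crosses l r Z' e}" for Z Z'
  proof
    assume sub: "Z \<subset> Z'"
    have "crosses l r (Z' - Z) e \<longleftrightarrow> crosses l r Z e \<noteq> crosses l r Z' e" for e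
      using sub by (auto simp: crosses_def)
    then have "cut_sum E l r x (Z' - Z) = 0"
      unfolding cut_sum_def using that(3) by (intro sum.neutral) blast
    moreover have "Z' - Z \<subseteq> V" "Z' - Z \<noteq> {}" "Z' - Z \<noteq> V" using sub that st by (auto simp: narrow_def)
    then have "1 \<le> cut_sum E l r x (Z' - Z)" using cuts[of "Z' - Z"] by (simp split: if_splits)
    ultimately show False by simp
  qed
  show ?thesis using narrow_chain[OF U W] no[OF U W eq] no[OF W U eq[symmetric]] by blast
qed

end

section \<open>Alternating colours and reconnection of the forest\<close>

locale st_path_lp_few_narrow = st_path_lp V E l r s t x
  for V :: "'v set" and E :: "'e set" and l r s t x +
  assumes few: "e \<in> E \<Longrightarrow> card {U \<in> narrow. crosses l r U e} \<le> 2"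
begin

text \<open>The parity of the position of \<open>U\<close> in the chain of narrow cuts.\<close>

definition colour :: "'v set \<Rightarrow> bool" where
  "colour U \<longleftrightarrow> odd (card {Z \<in> narrow. Z \<subset> U})"

text \<open>An edge crossing two sides of the chain crosses every side between them. As it crosses
  at most two, these are neighbours in the chain and differ in colour.\<close>

lemma colour_inj:
  assumes e: "e \<in> E" and U: "U \<in> narrow" "crosses l r U e" and W: "W \<in> narrow" "crosses l r W e"
    and col: "colour U = colour W"
  shows "U = W"
proof -
  have no: "\<not> U \<subset> W" if U: "U \<in> narrow" "crosses l r U e" and W: "W \<in> narrow" "crosses l r W e"
    and col: "colour U = colour W" for U W
  proof
    assume sub: "U \<subset> W"
    have between: "\<not> Z \<subset> W" if Z: "Z \<in> narrow" "U \<subset> Z" for Z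
    proof
      assume "Z \<subset> W"
      then have "crosses l r Z e" using U W sub Z by (auto simp: crosses_def)
      then have "{U, Z, W} \<subseteq> {U \<in> narrow. crosses l r U e}" using U W Z by auto
      then have "card {U, Z, W} \<le> card {U \<in> narrow. crosses l r U e}"
        using finite_narrow by (intro card_mono) auto
      moreover have "U \<noteq> Z" "Z \<noteq> W" "U \<noteq> W" using sub Z \<open>Z \<subset> W\<close> by auto
      then have "card {U, Z, W} = 3" by simp
      ultimately show False using few[OF e] by simp
    qed
    have "{Z \<in> narrow. Z \<subset> W} = insert U {Z \<in> narrow. Z \<subset> U}"
      using between narrow_chain U(1) sub by blast
    then have "card {Z \<in> narrow. Z \<subset> W} = Suc (card {Z \<in> narrow. Z \<subset> U})"
      using finite_narrow by simp
    then show False using col by (simp add: colour_def)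
  qed
  show ?thesis using no[OF U W col] no[OF W U col[symmetric]] narrow_chain[OF U(1) W(1)] by blast
qed

definition forest :: "'e set \<Rightarrow> bool \<Rightarrow> 'e set" where
  "forest S c = {e\<in>S. \<not> (\<exists>U\<in>narrow. colour U = c \<and> {f\<in>S. crosses l r U f} = {e})}"

text \<open>Suppose nothing crosses \<open>X\<close>. Then every level between neighbouring lonely
  cuts of colour \<open>c\<close> lies on one side of \<open>X\<close>. Since \<open>S\<close> is
  connected, some deleted edge \<open>e\<close> crosses \<open>X\<close>, and it is the lonely edge
  of some \<open>U\<close>. An edge of \<open>J\<close> crossing \<open>U\<close> joins the same two
  levels as \<open>e\<close>, so it crosses \<open>X\<close> too.\<close>

lemma connected_forest_Un:
  assumes S: "S \<subseteq> E" "connected_edges V l r S" and J: "J \<subseteq> E"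
    and hit: "\<And>U. U \<in> narrow \<Longrightarrow> colour U = c \<Longrightarrow> card {f\<in>S. crosses l r U f} = 1 \<Longrightarrow> \<exists>j\<in>J. crosses l r U j"
  shows "connected_edges V l r (forest S c \<union> J)"
  unfolding connected_edges_def
proof (intro allI impI)
  fix X assume X: "X \<subseteq> V \<and> X \<noteq> {} \<and> X \<noteq> V"
  show "\<exists>e\<in>forest S c \<union> J. crosses l r X e"
  proof (rule ccontr)
    assume none: "\<not> ?thesis"
    define M where "M = {U\<in>narrow. colour U = c \<and> card {f\<in>S. crosses l r U f} = 1}"
    have finM: "finite M" using finite_narrow by (simp add: M_def)
    have M_chain: "Z \<subseteq> Z' \<or> Z' \<subseteq> Z" if "Z \<in> M" "Z' \<in> M" for Z Z'
      using narrow_chain that by (auto simp: M_def)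
    have M_V: "Z \<subseteq> V" if "Z \<in> M" for Z using that by (auto simp: M_def narrow_def)
    have M_inj: "Z = Z'" if "Z \<in> M" "Z' \<in> M" "crosses l r Z e" "crosses l r Z' e" "e \<in> E" for Z Z' e
      using that colour_inj[of e Z Z'] by (auto simp: M_def)
    have M_one: "e = f" if "Z \<in> M" "e \<in> S" "f \<in> S" "crosses l r Z e" "crosses l r Z f" for Z e f
    proof -
      have "card {f\<in>S. crosses l r Z f} = 1" using that(1) by (simp add: M_def)
      then obtain g where "{f\<in>S. crosses l r Z f} = {g}" by (rule card_1_singletonE)
      moreover have "e \<in> {f\<in>S. crosses l r Z f}" "f \<in> {f\<in>S. crosses l r Z f}" using that by auto
      ultimately show ?thesis by simp
    qed
    have SV: "inside l r V e" if "e \<in> S" for e using that S ends by auto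
    have crossX: "\<exists>U\<in>M. crosses l r U e" if e: "e \<in> S" "crosses l r X e" for e
    proof -
      have "e \<notin> forest S c" using none e by auto
      then obtain U where U: "U \<in> narrow" "colour U = c" "{f\<in>S. crosses l r U f} = {e}"
        using e by (auto simp: forest_def)
      then have "crosses l r U e" by blast
      then show ?thesis using U by (auto simp: M_def)
    qed
    have level: "(K - L) \<inter> X = {} \<or> K - L \<subseteq> X"
      if LK: "L \<in> insert {} M" "K \<in> insert V M" "L \<subset> K"
        and gap: "\<And>Z. Z \<in> M \<Longrightarrow> Z \<subseteq> L \<or> K \<subseteq> Z" for L K
    proof (rule level_uncut[OF S(2) SV])
      have VL: "\<not> crosses l r V e" "\<not> crosses l r {} e" if "e \<in> S" for e
        using SV[OF that] by (auto simp: crosses_def inside_def)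
      show "\<not> crosses l r K e" if "e \<in> S" "crosses l r L e" for e
        using that LK M_inj[of L K e] VL[OF that(1)] S by auto
      show "e = f" if "e \<in> S" "f \<in> S" "crosses l r L e" "crosses l r L f" for e f
        using that LK M_one[of L e f] VL by auto
      show "e = f" if "e \<in> S" "f \<in> S" "crosses l r K e" "crosses l r K f" for e f
        using that LK M_one[of K e f] VL by auto
      show "\<not> crosses l r X e" if e: "e \<in> S" "inside l r (K - L) e" for e
      proof
        assume "crosses l r X e"
        then obtain Z where "Z \<in> M" "crosses l r Z e" using crossX[OF e(1)] by blast
        then show False using gap[of Z] e(2) by (auto simp: crosses_def inside_def)
      qed
    qed (use LK M_V in auto)
    obtain e where e: "e \<in> S" "crosses l r X e" using S(2) X unfolding connected_edges_def by blast
    obtain U where U: "U \<in> M" "crosses l r U e" using crossX[OF e] by blast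
    obtain j where j: "j \<in> J" "crosses l r U j" using hit[of U] U by (auto simp: M_def)
    have stU: "s \<in> U" "t \<notin> U" "U \<subseteq> V" using U by (auto simp: M_def narrow_def)
    \<comment> \<open>\<open>L\<close> and later \<open>K\<close> are the neighbours of
      \<open>U\<close> in the chain \<open>M\<close>; the empty set and \<open>V\<close> stand in
      where there is none.\<close>
    obtain L where L: "L \<in> insert {} M" "L \<subset> U" "\<And>Z. Z \<in> M \<Longrightarrow> Z \<subset> U \<Longrightarrow> Z \<subseteq> L"
    proof (cases "{Z\<in>M. Z \<subset> U} = {}")
      case True
      then show thesis using stU by (intro that[of "{}"]) auto
    next
      case False
      have *: "\<Union>{Z\<in>M. Z \<subset> U} \<in> {Z\<in>M. Z \<subset> U}"
        by (rule Union_in_chain[where \<A> = UNIV]) (use finM False M_chain in \<open>auto simp: subset_chain_def\<close>)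
      show thesis by (rule that[of "\<Union>{Z\<in>M. Z \<subset> U}"]) (use * in blast)+
    qed
    obtain K where K: "K \<in> insert V M" "U \<subset> K" "\<And>Z. Z \<in> M \<Longrightarrow> U \<subset> Z \<Longrightarrow> K \<subseteq> Z"
    proof (cases "{Z\<in>M. U \<subset> Z} = {}")
      case True
      then show thesis using stU st by (intro that[of V]) auto
    next
      case False
      have *: "\<Inter>{Z\<in>M. U \<subset> Z} \<in> {Z\<in>M. U \<subset> Z}"
        by (rule Inter_in_chain[where \<A> = UNIV]) (use finM False M_chain in \<open>auto simp: subset_chain_def\<close>)
      show thesis by (rule that[of "\<Inter>{Z\<in>M. U \<subset> Z}"]) (use * in blast)+
    qed
    have KV: "K \<subseteq> V" using K(1) M_V by auto
    have lo: "(U - L) \<inter> X = {} \<or> U - L \<subseteq> X"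
    proof (rule level[OF L(1) _ L(2)])
      show "Z \<subseteq> L \<or> U \<subseteq> Z" if "Z \<in> M" for Z
        using M_chain[OF that U(1)] L(3)[OF that] by blast
    qed (use U in simp)
    have hi: "(K - U) \<inter> X = {} \<or> K - U \<subseteq> X"
    proof (rule level[OF _ K(1,2)])
      show "Z \<subseteq> U \<or> K \<subseteq> Z" if "Z \<in> M" for Z
        using M_chain[OF that U(1)] K(3)[OF that] by blast
    qed (use U in simp)
    \<comment> \<open>An edge crosses at most one member of \<open>M\<close>. If that is
      \<open>U\<close>, it cannot reach beyond the two adjacent levels.\<close>
    have span: "(l f \<in> U - L \<and> r f \<in> K - U) \<or> (r f \<in> U - L \<and> l f \<in> K - U)"
      if f: "f \<in> E" "crosses l r U f" for f
    proof -
      have only: "\<not> crosses l r Z f" if "Z \<in> M" "Z \<noteq> U" for Z using M_inj[OF that(1) U(1) _ f(2,1)] that by blast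
      have fV: "l f \<in> V" "r f \<in> V" using ends[OF f(1)] by (auto simp: inside_def)
      have *: "a \<in> U - L \<and> b \<in> K - U"
        if "a \<in> U" "b \<notin> U" "b \<in> V" "\<And>Z. Z \<in> M \<Longrightarrow> Z \<noteq> U \<Longrightarrow> a \<in> Z \<longleftrightarrow> b \<in> Z" for a b
      proof -
        have "a \<notin> L" using L(1,2) that by blast
        moreover have "b \<in> K" using K(1,2) that by blast
        ultimately show ?thesis using that by simp
      qed
      show ?thesis
      proof (cases "l f \<in> U")
        case True
        then show ?thesis using *[of "l f" "r f"] f fV only by (auto simp: crosses_def)
      next
        case False
        then show ?thesis using *[of "r f" "l f"] f fV only by (auto simp: crosses_def)
      qed
    qed
    have "e \<in> E" "j \<in> E" using e j S J by auto
    \<comment> \<open>\<open>P\<close> and \<open>Q\<close> record on which side of \<open>X\<close>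
      the lower and the upper level lie.\<close>
    obtain P where P: "\<forall>a\<in>U - L. (a \<in> X) = P" using lo that[of True] that[of False] by blast
    obtain Q where Q: "\<forall>a\<in>K - U. (a \<in> X) = Q" using hi that[of True] that[of False] by blast
    have crX: "crosses l r X f \<longleftrightarrow> P \<noteq> Q" if "f \<in> E" "crosses l r U f" for f
      using span[OF that]
    proof
      assume "l f \<in> U - L \<and> r f \<in> K - U"
      then have "(l f \<in> X) = P" "(r f \<in> X) = Q" using P Q by simp_all
      then show ?thesis by (simp add: crosses_def)
    next
      assume "r f \<in> U - L \<and> l f \<in> K - U"
      then have "(r f \<in> X) = P" "(l f \<in> X) = Q" using P Q by simp_all
      then show ?thesis by (auto simp: crosses_def)
    qed
    have "crosses l r X j"
      using crX[OF \<open>e \<in> E\<close> U(2)] crX[OF \<open>j \<in> E\<close> j(2)] e(2) by simp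
    then show False using none j by auto
  qed
qed

section \<open>Parity correction and the random tour\<close>

definition odd_vertices :: "'e set \<Rightarrow> 'v set" where
  "odd_vertices F = {v\<in>V. odd (card {e\<in>F. crosses l r {v} e})}"

text \<open>\<open>F\<close> is a join for its own odd vertices, so its cut parities are known; the
  pair \<open>{s, t}\<close> flips exactly the cuts separating \<open>s\<close> from
  \<open>t\<close>. The symmetric difference is the terminal set of the correcting join.\<close>

lemma odd_cut_sym_diff:
  assumes F: "F \<subseteq> E" and U: "U \<subseteq> V"
  shows "odd (card (U \<inter> sym_diff (odd_vertices F) {s, t})) \<longleftrightarrow>
    odd (card {e\<in>F. crosses l r U e}) \<noteq> ((s \<in> U) \<noteq> (t \<in> U))"
proof -
  have fin: "finite U" "finite F" using F U finE finV by (auto intro: finite_subset)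
  have "tjoin V l r (odd_vertices F) F" by (auto simp: tjoin_def odd_vertices_def)
  then have "odd (card {e\<in>F. crosses l r U e}) \<longleftrightarrow> odd (card (U \<inter> odd_vertices F))"
    using tjoin_cut_parity fin U by blast
  moreover have "odd (card (U \<inter> {s, t})) \<longleftrightarrow> (s \<in> U) \<noteq> (t \<in> U)"
    using st by (cases "s \<in> U"; cases "t \<in> U") (auto simp: Int_insert_right)
  moreover have "U \<inter> sym_diff (odd_vertices F) {s, t} = sym_diff (U \<inter> odd_vertices F) (U \<inter> {s, t})" by blast
  ultimately show ?thesis using odd_card_sym_diff[of "U \<inter> odd_vertices F" "U \<inter> {s, t}"] fin by auto
qed

definition lonely :: "'e set \<Rightarrow> 'v set \<Rightarrow> 'e \<Rightarrow> bool" where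
  "lonely S U e \<longleftrightarrow> {f\<in>S. crosses l r U f} = {e}"

definition tour_multiset :: "'e set \<Rightarrow> 'e set \<Rightarrow> 'e multiset" where
  "tour_multiset F J = mset_set F + mset_set J"

definition is_tour :: "'e multiset \<Rightarrow> bool" where
  "is_tour K \<longleftrightarrow> set_mset K \<subseteq> E \<and> connected_edges V l r (set_mset K) \<and>
     {v\<in>V. odd (size (filter_mset (crosses l r {v}) K))} = {s, t}"

lemma is_tour_forest_Un:
  assumes S: "S \<subseteq> E" "connected_edges V l r S" and J: "J \<subseteq> E"
    and tj: "tjoin V l r (sym_diff (odd_vertices (forest S c)) {s, t}) J"
  shows "is_tour (tour_multiset (forest S c) J)"
proof -
  let ?F = "forest S c"
  have F: "?F \<subseteq> E" using S by (auto simp: forest_def)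
  have fin: "finite ?F" "finite J" using F J finE by (auto intro: finite_subset)
  have "\<exists>j\<in>J. crosses l r U j" if U: "U \<in> narrow" "colour U = c" "card {f\<in>S. crosses l r U f} = 1" for U
  proof -
    have UV: "U \<subseteq> V" "s \<in> U" "t \<notin> U" using U by (auto simp: narrow_def)
    obtain e where e: "{f\<in>S. crosses l r U f} = {e}" using U(3) by (rule card_1_singletonE)
    have F0: "{f\<in>?F. crosses l r U f} = {}"
    proof -
      have "f = e" if "f \<in> S" "crosses l r U f" for f using e that by auto
      moreover have "e \<notin> ?F" using U e by (auto simp: forest_def)
      moreover have "?F \<subseteq> S" by (auto simp: forest_def)
      ultimately show ?thesis by blast
    qed
    have "odd (card (U \<inter> sym_diff (odd_vertices ?F) {s, t}))"
      unfolding odd_cut_sym_diff[OF F UV(1)] F0 using UV by simp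
    then have "odd (card {j\<in>J. crosses l r U j})"
      using tjoin_cut_parity[OF fin(2) tj _ UV(1)] UV(1) finV by (auto intro: finite_subset)
    then have "{j\<in>J. crosses l r U j} \<noteq> {}" by (metis card.empty even_zero)
    then show ?thesis by blast
  qed
  then have "connected_edges V l r (?F \<union> J)" by (intro connected_forest_Un S J)
  moreover have "odd (size (filter_mset (crosses l r {v}) (tour_multiset ?F J))) \<longleftrightarrow> v \<in> {s, t}" if v: "v \<in> V" for v
  proof -
    have "size (filter_mset (crosses l r {v}) (tour_multiset ?F J))
      = card {e\<in>?F. crosses l r {v} e} + card {e\<in>J. crosses l r {v} e}"
      using fin by (simp add: tour_multiset_def filter_mset_mset_set)
    moreover have "odd (card {e\<in>J. crosses l r {v} e}) \<longleftrightarrow> v \<in> sym_diff (odd_vertices ?F) {s, t}"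
      using tj v by (simp add: tjoin_def)
    ultimately show ?thesis using v by (auto simp: odd_vertices_def)
  qed
  ultimately show ?thesis
    using F J fin st by (auto simp: is_tour_def tour_multiset_def)
qed

text \<open>By \<open>colour_inj\<close> the sum over narrow cuts has at most one nonzero term per colour.\<close>

lemma forest_count:
  assumes S: "S \<subseteq> E" and e: "e \<in> E"
  shows "of_bool (e \<in> forest S True) + of_bool (e \<in> forest S False)
    \<le> 2 * of_bool (e \<in> S) - (\<Sum>U\<in>narrow. of_bool (lonely S U e) :: real)"
proof -
  define N where "N c = {U\<in>narrow. colour U = c \<and> lonely S U e}" for c
  have finN: "finite (N c)" for c using finite_narrow by (simp add: N_def)
  have crosses: "crosses l r U e" "e \<in> S" if "lonely S U e" for U
    using that by (auto simp: lonely_def)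
  have "card (N c) \<le> of_bool (N c \<noteq> {})" for c
  proof (cases "N c = {}")
    case False
    then obtain U where U: "U \<in> N c" by auto
    have "N c \<subseteq> {U}" using colour_inj[OF e] crosses U by (auto simp: N_def)
    then have "card (N c) \<le> card {U}" by (intro card_mono) auto
    then show ?thesis using False by simp
  qed simp
  moreover have "of_bool (e \<in> forest S c) = (of_bool (e \<in> S) - of_bool (N c \<noteq> {}) :: real)" for c
    using crosses by (auto simp: forest_def N_def lonely_def)
  moreover have "(\<Sum>U\<in>narrow. of_bool (lonely S U e) :: real) = real (card (N True)) + real (card (N False))"
  proof -
    have "(\<Sum>U\<in>narrow. of_bool (lonely S U e) :: real) = real (card {U\<in>narrow. lonely S U e})"
      using finite_narrow by (simp add: sum_of_bool_eq Int_def)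
    also have "{U\<in>narrow. lonely S U e} = N True \<union> N False" by (auto simp: N_def)
    also have "card \<dots> = card (N True) + card (N False)"
      by (intro card_Un_disjoint finN) (auto simp: N_def)
    finally show ?thesis by simp
  qed
  ultimately show ?thesis
    by (smt (verit) of_nat_le_iff of_nat_of_bool)
qed

text \<open>With \<open>k\<close> edges of \<open>S\<close> in the cut, connectivity gives
  \<open>k \<ge> 1\<close>. So \<open>2 - k\<close> is 1 if the only edge is lonely, and at most 0
  otherwise.\<close>

lemma lonely_lower_bound:
  assumes S: "S \<subseteq> E" "connected_edges V l r S" and U: "U \<in> narrow"
  shows "2 - (\<Sum>e | e \<in> E \<and> crosses l r U e. of_bool (e \<in> S))
    \<le> (\<Sum>e | e \<in> E \<and> crosses l r U e. of_bool (lonely S U e) :: real)"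
proof -
  let ?D = "{e. e \<in> E \<and> crosses l r U e}"
  have finD: "finite ?D" using finE by simp
  have SU: "{f\<in>S. crosses l r U f} \<subseteq> ?D" using S by auto
  have finSU: "finite {f\<in>S. crosses l r U f}" using SU finD by (rule finite_subset)
  have count: "(\<Sum>e\<in>?D. of_bool (e \<in> S) :: real) = real (card {f\<in>S. crosses l r U f})"
  proof -
    have "{e\<in>?D. e \<in> S} = {f\<in>S. crosses l r U f}" using S by auto
    then show ?thesis using finD by (simp add: sum_of_bool_eq Int_def)
  qed
  have "U \<subseteq> V" "U \<noteq> {}" "U \<noteq> V" using U st by (auto simp: narrow_def)
  then have "{f\<in>S. crosses l r U f} \<noteq> {}" using S(2) unfolding connected_edges_def by blast
  then have "card {f\<in>S. crosses l r U f} > 0" using finSU unfolding card_gt_0_iff by blast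
  then consider "card {f\<in>S. crosses l r U f} = 1" | "card {f\<in>S. crosses l r U f} \<ge> 2" by linarith
  then show ?thesis
  proof cases
    case 1
    then obtain e where e: "{f\<in>S. crosses l r U f} = {e}" by (rule card_1_singletonE)
    then have "e \<in> ?D" using SU by blast
    then have "of_bool (lonely S U e) \<le> (\<Sum>e\<in>?D. of_bool (lonely S U e) :: real)"
      using finD by (intro member_le_sum) auto
    then show ?thesis using 1 e unfolding count by (simp add: lonely_def)
  next
    case 2
    have "0 \<le> (\<Sum>e\<in>?D. of_bool (lonely S U e) :: real)" by (intro sum_nonneg) simp
    then show ?thesis using 2 unfolding count by linarith
  qed
qed

lemma dominates_tours:
  "\<exists>q. finite (set_pmf q) \<and> set_pmf q \<subseteq> Collect is_tour \<and>
    (\<forall>e\<in>E. measure_pmf.expectation q (\<lambda>K. real (count K e)) \<le> 3 / 2 * x e)"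
proof -
  obtain p where p: "set_pmf p \<subseteq> {S. connected_edges V l r S} \<inter> Pow E" "\<And>e. e \<in> E \<Longrightarrow> marginal p e \<le> x e"
    using spanning_trees unfolding dominates_mixture_def by blast
  have finp: "finite (set_pmf p)" using p(1) finE by (meson finite_Pow_iff finite_subset le_inf_iff)
  note int_p = integrable_measure_pmf_finite[OF finp]
  have S: "S \<subseteq> E" "connected_edges V l r S" if "S \<in> set_pmf p" for S using p(1) that by auto
  \<comment> \<open>The probability that \<open>e\<close> is the lonely edge of
    \<open>U\<close>.\<close>
  define m where "m U e = (measure_pmf.expectation p (\<lambda>S. of_bool (lonely S U e)) :: real)" for U e
  define y where "y e = x e / 2 + (\<Sum>U\<in>narrow. m U e) / 2" for e
  have m0: "0 \<le> m U e" for U e by (simp add: m_def)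
  have y_narrow: "1 \<le> cut_sum E l r y U" if U: "U \<in> narrow" for U
  proof -
    let ?D = "{e. e \<in> E \<and> crosses l r U e}"
    have "2 - (\<Sum>e\<in>?D. marginal p e) = measure_pmf.expectation p (\<lambda>S. 2 - (\<Sum>e\<in>?D. of_bool (e \<in> S)))"
      by (simp add: int_p Bochner_Integration.integral_sum Bochner_Integration.integral_diff)
    also have "\<dots> \<le> measure_pmf.expectation p (\<lambda>S. \<Sum>e\<in>?D. of_bool (lonely S U e))"
      using lonely_lower_bound[OF S U] by (intro expectation_mono_finite finp)
    also have "\<dots> = (\<Sum>e\<in>?D. m U e)"
      by (simp add: int_p m_def Bochner_Integration.integral_sum)
    finally have "2 - (\<Sum>e\<in>?D. marginal p e) \<le> (\<Sum>e\<in>?D. m U e)" .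
    moreover have "(\<Sum>e\<in>?D. marginal p e) \<le> cut_sum E l r x U"
      unfolding cut_sum_def using p(2) by (intro sum_mono) auto
    ultimately have "2 - cut_sum E l r x U \<le> (\<Sum>e\<in>?D. m U e)" by simp
    moreover have "(\<Sum>e\<in>?D. x e / 2 + m U e / 2) \<le> cut_sum E l r y U"
      unfolding cut_sum_def
    proof (rule sum_mono)
      fix e
      have "m U e \<le> (\<Sum>U\<in>narrow. m U e)" using U finite_narrow m0 by (intro member_le_sum) auto
      then show "x e / 2 + m U e / 2 \<le> y e" by (simp add: y_def)
    qed
    moreover have "(\<Sum>e\<in>?D. x e / 2 + m U e / 2) = cut_sum E l r x U / 2 + (\<Sum>e\<in>?D. m U e) / 2"
      by (simp add: cut_sum_def sum.distrib sum_divide_distrib)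
    ultimately show ?thesis by simp
  qed
  have compl: "cut_sum E l r z (V - U) = cut_sum E l r z U" if "U \<subseteq> V" for z U
    unfolding cut_sum_def using ends that by (intro sum.cong) (auto simp: crosses_def inside_def)
  have y_cut: "1 \<le> cut_sum E l r y U" if U: "U \<subseteq> V" "U \<noteq> {}" "U \<noteq> V" for U
  proof (cases "2 \<le> cut_sum E l r x U")
    case True
    have "cut_sum E l r x U / 2 \<le> cut_sum E l r y U"
      unfolding cut_sum_def sum_divide_distrib y_def
      using m0 by (intro sum_mono) (simp add: sum_nonneg)
    then show ?thesis using True by simp
  next
    case False
    then have "(s \<in> U) \<noteq> (t \<in> U)" using cuts[OF U] by (auto split: if_splits)
    \<comment> \<open>Only sides containing \<open>s\<close> are in \<open>narrow\<close>; the
      complement has the same cut value.\<close>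
    then have "U \<in> narrow \<or> V - U \<in> narrow"
      using False U st by (auto simp: narrow_def compl)
    then show ?thesis using y_narrow[of U] y_narrow[of "V - U"] compl[OF U(1)] by auto
  qed
  \<comment> \<open>\<open>y\<close> is at least 1 on all proper cuts, whatever their parity, so it
    is feasible for the terminal set of every tree and colour.\<close>
  have "\<exists>q. set_pmf q \<subseteq> {J. tjoin V l r (sym_diff (odd_vertices (forest S c)) {s, t}) J} \<inter> Pow E \<and>
      (\<forall>e\<in>E. marginal q e \<le> y e)" if "S \<in> set_pmf p" for S c
  proof -
    let ?T = "sym_diff (odd_vertices (forest S c)) {s, t}"
    have F: "forest S c \<subseteq> E" using S[OF that] by (auto simp: forest_def)
    have no_cross: "{e\<in>forest S c. crosses l r V e} = {}" "{e\<in>forest S c. crosses l r {} e} = {}"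
      using F ends by (auto simp: crosses_def inside_def)
    have "tjoin_feasible E V l r ?T y"
      unfolding tjoin_feasible_def
    proof (intro conjI ballI allI impI)
      show "?T \<subseteq> V" using st by (auto simp: odd_vertices_def)
      fix e assume "e \<in> E"
      then show "inside l r V e" "0 \<le> y e" using ends nonneg m0 by (auto simp: y_def sum_nonneg)
    next
      fix U assume U: "U \<subseteq> V \<and> odd (card (U \<inter> ?T))"
      then have odd: "odd (card {e\<in>forest S c. crosses l r U e}) \<noteq> ((s \<in> U) \<noteq> (t \<in> U))"
        using odd_cut_sym_diff[OF F, of U] by blast
      have "U \<noteq> {}" using U by auto
      moreover have "U \<noteq> V"
      proof
        assume "U = V"
        then show False using odd st unfolding no_cross by (simp add: no_cross)
      qed
      ultimately show "1 \<le> cut_sum E l r y U" using y_cut U by blast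
    qed
    then show ?thesis using tjoin_decomposition[OF finV _ finE] unfolding dominates_mixture_def by blast
  qed
  note tjoin_mixture = someI_ex[OF this]
  define q where "q S c = (SOME q. set_pmf q \<subseteq> {J. tjoin V l r (sym_diff (odd_vertices (forest S c)) {s, t}) J} \<inter> Pow E \<and>
      (\<forall>e\<in>E. marginal q e \<le> y e))" for S c
  have q: "\<And>S c. S \<in> set_pmf p \<Longrightarrow>
      set_pmf (q S c) \<subseteq> {J. tjoin V l r (sym_diff (odd_vertices (forest S c)) {s, t}) J} \<inter> Pow E"
      "\<And>S c e. S \<in> set_pmf p \<Longrightarrow> e \<in> E \<Longrightarrow> marginal (q S c) e \<le> y e"
    using tjoin_mixture unfolding q_def[symmetric] by simp_all
  have finq: "finite (set_pmf (q S c))" if "S \<in> set_pmf p" for S c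
    using q(1)[OF that] finE by (meson finite_Pow_iff finite_subset le_inf_iff)
  define R where "R c = bind_pmf p (\<lambda>S. map_pmf (tour_multiset (forest S c)) (q S c))" for c
  \<comment> \<open>A fair coin selects the colour, independently of the tree.\<close>
  define Q where "Q = bind_pmf (bernoulli_pmf (1 / 2)) R"
  have finR: "finite (set_pmf (R c))" for c using finp finq by (auto simp: R_def)
  have tours: "set_pmf (R c) \<subseteq> Collect is_tour" for c
  proof
    fix K assume "K \<in> set_pmf (R c)"
    then obtain S' J where SJ: "S' \<in> set_pmf p" "J \<in> set_pmf (q S' c)" "K = tour_multiset (forest S' c) J"
      by (auto simp: R_def)
    then have "J \<in> {J. tjoin V l r (sym_diff (odd_vertices (forest S' c)) {s, t}) J} \<inter> Pow E"
      using q(1)[OF SJ(1)] by blast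
    then show "K \<in> Collect is_tour"
      using is_tour_forest_Un[OF S[OF SJ(1)]] SJ(3) by simp
  qed
  have ER: "measure_pmf.expectation (R c) (\<lambda>K. real (count K e))
      \<le> measure_pmf.expectation p (\<lambda>S. of_bool (e \<in> forest S c)) + y e" if e: "e \<in> E" for c e
  proof -
    have "measure_pmf.expectation (R c) (\<lambda>K. real (count K e))
      = measure_pmf.expectation p (\<lambda>S. measure_pmf.expectation (q S c)
          (\<lambda>J. real (count (tour_multiset (forest S c) J) e)))"
      unfolding R_def using finp finq by (subst expectation_bind_pmf) auto
    also have "\<dots> \<le> measure_pmf.expectation p (\<lambda>S. of_bool (e \<in> forest S c) + y e)"
    proof (intro expectation_mono_finite finp)
      fix S assume Sp: "S \<in> set_pmf p"
      have "finite (forest S c)" using S[OF Sp] finE by (auto simp: forest_def intro: finite_subset)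
      moreover have "finite J" if "J \<in> set_pmf (q S c)" for J
        using q(1)[OF Sp] that finE by (blast intro: finite_subset)
      ultimately have "measure_pmf.expectation (q S c) (\<lambda>J. real (count (tour_multiset (forest S c) J) e))
        = measure_pmf.expectation (q S c) (\<lambda>J. of_bool (e \<in> forest S c) + of_bool (e \<in> J))"
        by (intro expectation_cong) (simp add: tour_multiset_def count_mset_set')
      also have "\<dots> = of_bool (e \<in> forest S c) + marginal (q S c) e"
        using finq[OF Sp] by (simp add: integrable_measure_pmf_finite)
      also have "\<dots> \<le> of_bool (e \<in> forest S c) + y e" using q(2)[OF Sp e] by simp
      finally show "measure_pmf.expectation (q S c) (\<lambda>J. real (count (tour_multiset (forest S c) J) e)) \<le> \<dots>" .
    qed
    also have "\<dots> = measure_pmf.expectation p (\<lambda>S. of_bool (e \<in> forest S c)) + y e"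
      by (simp add: int_p)
    finally show ?thesis .
  qed
  have "measure_pmf.expectation Q (\<lambda>K. real (count K e)) \<le> 3 / 2 * x e" if e: "e \<in> E" for e
  proof -
    let ?f = "\<lambda>c. measure_pmf.expectation p (\<lambda>S. of_bool (e \<in> forest S c)) :: real"
    have "?f True + ?f False
      = measure_pmf.expectation p (\<lambda>S. of_bool (e \<in> forest S True) + of_bool (e \<in> forest S False))"
      by (simp add: int_p)
    also have "\<dots> \<le> measure_pmf.expectation p (\<lambda>S. 2 * of_bool (e \<in> S) - (\<Sum>U\<in>narrow. of_bool (lonely S U e)))"
      using forest_count S e by (intro expectation_mono_finite finp) blast
    also have "\<dots> = 2 * marginal p e - (\<Sum>U\<in>narrow. m U e)"
      by (simp add: int_p m_def Bochner_Integration.integral_sum Bochner_Integration.integral_diff)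
    also have "\<dots> \<le> 2 * x e - (\<Sum>U\<in>narrow. m U e)" using p(2)[OF e] by simp
    finally have "?f True + ?f False \<le> 2 * x e - (\<Sum>U\<in>narrow. m U e)" .
    moreover have "measure_pmf.expectation Q (\<lambda>K. real (count K e))
      = (measure_pmf.expectation (R True) (\<lambda>K. real (count K e))
        + measure_pmf.expectation (R False) (\<lambda>K. real (count K e))) / 2"
      unfolding Q_def using finR by (subst expectation_bind_pmf) (auto intro: finite_subset[OF subset_UNIV])
    ultimately show ?thesis using ER[OF e, of True] ER[OF e, of False] by (simp add: y_def)
  qed
  moreover have "finite (set_pmf Q)" using finR by (auto simp: Q_def intro: finite_subset[OF subset_UNIV])
  moreover have "set_pmf Q \<subseteq> Collect is_tour" using tours by (auto simp: Q_def)
  ultimately show ?thesis by blast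
qed

lemma is_tour_double:
  assumes K: "is_tour K" and e: "e \<in> E"
  shows "is_tour (K + replicate_mset (2 * k) e)"
proof -
  let ?K = "K + replicate_mset (2 * k) e"
  have sub: "set_mset K \<subseteq> set_mset ?K" by simp
  have "connected_edges V l r (set_mset ?K)"
    unfolding connected_edges_def
  proof (intro allI impI)
    fix U assume "U \<subseteq> V \<and> U \<noteq> {} \<and> U \<noteq> V"
    then obtain f where "f \<in> set_mset K" "crosses l r U f"
      using K unfolding is_tour_def connected_edges_def by blast
    then show "\<exists>f\<in>set_mset ?K. crosses l r U f" using sub by (intro bexI[of _ f]) auto
  qed
  moreover have "size (filter_mset (crosses l r {v}) ?K)
    = size (filter_mset (crosses l r {v}) K) + (if crosses l r {v} e then 2 * k else 0)" for v
  proof -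
    have "size (filter_mset P (replicate_mset n e)) = (if P e then n else 0)" for P n
      by (induction n) auto
    then show ?thesis by simp
  qed
  then have "odd (size (filter_mset (crosses l r {v}) ?K)) \<longleftrightarrow> odd (size (filter_mset (crosses l r {v}) K))" for v
    by simp
  moreover have "set_mset ?K \<subseteq> E"
    using K e by (auto simp: is_tour_def split: if_splits)
  ultimately show ?thesis using K unfolding is_tour_def by simp
qed

end

section \<open>Turning domination into equality\<close>

lemma fill_slack:
  fixes z :: "'e \<Rightarrow> real"
  assumes finX: "finite X" and tours: "\<And>K e k. P K \<Longrightarrow> e \<in> X \<Longrightarrow> P (K + replicate_mset (2 * k) e)"
    and q: "finite (set_pmf q)" "set_pmf q \<subseteq> Collect P"
    and le: "\<And>e. e \<in> X \<Longrightarrow> measure_pmf.expectation q (\<lambda>K. real (count K e)) \<le> z e"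
  shows "\<exists>q. finite (set_pmf q) \<and> set_pmf q \<subseteq> Collect P \<and>
     (\<forall>e\<in>X. measure_pmf.expectation q (\<lambda>K. real (count K e)) = z e)"
proof -
  let ?E = "\<lambda>q e. measure_pmf.expectation q (\<lambda>K. real (count K e))"
  have "\<exists>q. finite (set_pmf q) \<and> set_pmf q \<subseteq> Collect P \<and> (\<forall>e\<in>X. ?E q e \<le> z e) \<and> (\<forall>e\<in>Y. ?E q e = z e)"
    if "finite Y" "Y \<subseteq> X" for Y
    using that
  proof (induction Y rule: finite_induct)
    case empty
    then show ?case using q le by auto
  next
    case (insert a Y)
    then obtain q where q: "finite (set_pmf q)" "set_pmf q \<subseteq> Collect P"
      "\<forall>e\<in>X. ?E q e \<le> z e" "\<forall>e\<in>Y. ?E q e = z e" by auto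
    define d where "d = z a - ?E q a"
    have d: "0 \<le> d" using q insert by (auto simp: d_def)
    \<comment> \<open>Adding \<open>2 * k\<close> copies with probability \<open>d / (2 * k)\<close>
      raises the mean by exactly \<open>d\<close>. The slack may exceed 2, so \<open>k\<close> is
      taken larger than \<open>d\<close> to keep this a probability.\<close>
    obtain k :: nat where k: "d < real k" using reals_Archimedean2 by blast
    define c where "c = d / (2 * real k)"
    have c: "0 \<le> c" "c \<le> 1" "c * (2 * real k) = d" using d k by (auto simp: c_def field_simps)
    define q' where "q' = bind_pmf (bernoulli_pmf c) (\<lambda>b. map_pmf (\<lambda>K. K + replicate_mset (if b then 2 * k else 0) a) q)"
    have fin: "finite (set_pmf q')" using q by (auto simp: q'_def intro: finite_subset[OF subset_UNIV])
    have "a \<in> X" using insert by auto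
    then have supp: "set_pmf q' \<subseteq> Collect P" using q(2) tours by (auto simp: q'_def)
    have "?E q' e = ?E q e + (if e = a then d else 0)" for e
    proof -
      have "?E q' e = c * (?E q e + (if e = a then 2 * real k else 0)) + (1 - c) * ?E q e"
        unfolding q'_def using q(1) c(1,2)
        by (subst expectation_bind_pmf)
          (auto intro: finite_subset[OF subset_UNIV] simp: integrable_measure_pmf_finite algebra_simps)
      then show ?thesis using c(3) by (auto simp: algebra_simps)
    qed
    then show ?case using fin supp q(3,4) insert by (intro exI[of _ q']) (auto simp: d_def)
  qed
  from this[OF finX subset_refl] show ?thesis by blast
qed

section \<open>Translation to vertex pairs and finite sums\<close>

theorem theorem12:
  fixes V :: "'a set" and s t :: 'a and x :: "'a set \<Rightarrow> real"
  assumes "finite V" and "s \<in> V" and "t \<in> V"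
    and "subtour_feasible V s t x"
    and "\<forall>e \<in> support_edges V x. card {Q \<in> narrow_cuts V x. e \<in> Q} \<le> 2"
  shows "convex_comb_of_incidence_vectors (vertex_pairs V)
           {J. st_tour V (support_edges V x) s t J} (\<lambda>e. 3 / 2 * x e)"
proof -
  define E where "E = support_edges V x"
  have finP: "finite (vertex_pairs V)"
    using assms(1) by (auto simp: vertex_pairs_def intro: finite_subset[of _ "Pow V"])
  have EP: "E \<subseteq> vertex_pairs V" and finE: "finite E"
    using finP by (auto simp: E_def support_edges_def)
  \<comment> \<open>An arbitrary ordering of the two ends of each pair supplies the end
    maps.\<close>
  have "\<forall>e\<in>vertex_pairs V. \<exists>a b. e = {a, b} \<and> a \<noteq> b"
    by (auto simp: vertex_pairs_def card_2_iff)
  then obtain l r where lr: "\<And>e. e \<in> vertex_pairs V \<Longrightarrow> e = {l e, r e} \<and> l e \<noteq> r e"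
    by metis
  have inV: "inside l r V e" if "e \<in> vertex_pairs V" for e
  proof -
    have "e \<subseteq> V" using that by (simp add: vertex_pairs_def)
    then show ?thesis using lr[OF that] unfolding inside_def by blast
  qed
  have cross1: "card (e \<inter> U) = 1 \<longleftrightarrow> crosses l r U e" if "e \<in> vertex_pairs V" for e U
  proof -
    have "card ({a, b} \<inter> U) = 1 \<longleftrightarrow> (a \<in> U) \<noteq> (b \<in> U)" if "a \<noteq> b" for a b
      using that by (cases "a \<in> U"; cases "b \<in> U") auto
    then show ?thesis using lr[OF that] unfolding crosses_def by metis
  qed
  have cut_edges: "cut_edges V U = {e. e \<in> vertex_pairs V \<and> crosses l r U e}" for U
    using cross1 by (auto simp: cut_edges_def)
  have nonneg: "0 \<le> x e" if "e \<in> vertex_pairs V" for e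
    using assms(4) that by (simp add: subtour_feasible_def)
  have x0: "x e = 0" if "e \<in> vertex_pairs V - E" for e
    using that nonneg[of e] by (force simp: E_def support_edges_def)
  have cut_x: "(\<Sum>e\<in>cut_edges V U. x e) = cut_sum E l r x U" for U
    unfolding cut_sum_def cut_edges using finP EP x0
    by (intro sum.mono_neutral_right) auto
  have deg: "cut_sum E l r x {v} = cut_demand s t {v}" if "v \<in> V" for v
    using assms(4) that unfolding cut_x[symmetric] by (simp add: subtour_feasible_def)
  have cut: "cut_demand s t U \<le> cut_sum E l r x U" if "U \<noteq> {}" "U \<subset> V" for U
    using assms(4) that unfolding cut_x[symmetric] by (simp add: subtour_feasible_def)
  have compl: "crosses l r (V - U) e \<longleftrightarrow> crosses l r U e" if "e \<in> E" "U \<subseteq> V" for U e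
    using inV[of e] EP that by (auto simp: crosses_def inside_def)
  have cut_compl: "cut_sum E l r x (V - U) = cut_sum E l r x U" if "U \<subseteq> V" for U
    unfolding cut_sum_def using compl that by (intro sum.cong) auto
  \<comment> \<open>If \<open>s = t\<close>, the degree equation at \<open>s\<close> demands 1, but
    \<open>V - {s}\<close> has the same cut and demands 2; if \<open>V = {s}\<close>, the cut is
    empty.\<close>
  have "s \<noteq> t"
  proof
    assume "s = t"
    then have 1: "cut_sum E l r x {s} = 1" using deg[OF assms(2)] by (simp add: cut_demand_def)
    show False
    proof (cases "V = {s}")
      case True
      have "cut_sum E l r x {s} = 0"
        unfolding cut_sum_def using inV EP True by (intro sum.neutral) (auto simp: crosses_def inside_def)
      then show False using 1 by simp
    next
      case False
      then have "V - {s} \<noteq> {}" "V - {s} \<subset> V" using assms(2) by auto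
      then have "cut_demand s t (V - {s}) \<le> cut_sum E l r x {s}"
        using cut[of "V - {s}"] cut_compl[of "{s}"] assms(2) by simp
      then show False using 1 \<open>s = t\<close> by (simp add: cut_demand_def)
    qed
  qed
  have demand: "cut_demand s t U = (if (s \<in> U) \<noteq> (t \<in> U) then 1 else 2)" for U
    using \<open>s \<noteq> t\<close> by (cases "s \<in> U"; cases "t \<in> U") (auto simp: cut_demand_def)
  interpret st_path_lp V E l r s t x
  proof
    show "cut_sum E l r x {v} = (if v \<in> {s, t} then 1 else 2)" if "v \<in> V" for v
      using deg[OF that] \<open>s \<noteq> t\<close> by (auto simp: demand)
    show "(if (s \<in> U) \<noteq> (t \<in> U) then 1 else 2) \<le> cut_sum E l r x U"
      if "U \<subseteq> V" "U \<noteq> {}" "U \<noteq> V" for U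
      using cut[of U] that by (auto simp: demand)
  qed (use assms(1-3) finE EP inV lr nonneg \<open>s \<noteq> t\<close> in auto)
  interpret st_path_lp_few_narrow V E l r s t x
  proof
    fix e assume e: "e \<in> E"
    \<comment> \<open>Injective on narrow sides and with narrow cuts as values, so the hypothesis on
      edge sets bounds the number of sides.\<close>
    let ?Q = "\<lambda>U. {f\<in>E. crosses l r U f}"
    have "?Q ` {U \<in> narrow. crosses l r U e} \<subseteq> {Q \<in> narrow_cuts V x. e \<in> Q}"
    proof
      fix Q assume "Q \<in> ?Q ` {U \<in> narrow. crosses l r U e}"
      then obtain U where U: "U \<in> narrow" "crosses l r U e" "Q = ?Q U" by auto
      have "Q = cut_edges V U \<inter> support_edges V x"
        using EP unfolding U(3) cut_edges E_def by auto
      moreover have "(\<Sum>e\<in>Q. x e) < 2" using U by (simp add: narrow_def cut_sum_def)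
      moreover have "U \<noteq> {}" "U \<subset> V" using U(1) assms(3) by (auto simp: narrow_def)
      ultimately show "Q \<in> {Q \<in> narrow_cuts V x. e \<in> Q}" using U e by (auto simp: narrow_cuts_def)
    qed
    moreover have "finite {Q \<in> narrow_cuts V x. e \<in> Q}"
      using finE by (auto simp: narrow_cuts_def E_def intro: finite_subset[of _ "Pow (support_edges V x)"])
    ultimately have "card (?Q ` {U \<in> narrow. crosses l r U e}) \<le> card {Q \<in> narrow_cuts V x. e \<in> Q}"
      by (intro card_mono)
    moreover have "inj_on ?Q {U \<in> narrow. crosses l r U e}"
      using narrow_determined_by_edges by (intro inj_onI) blast
    ultimately show "card {U \<in> narrow. crosses l r U e} \<le> 2"
      using assms(5) e by (force simp: card_image E_def)
  qed
  obtain q0 where "finite (set_pmf q0)" "set_pmf q0 \<subseteq> Collect is_tour"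
    "\<forall>e\<in>E. measure_pmf.expectation q0 (\<lambda>K. real (count K e)) \<le> 3 / 2 * x e"
    using dominates_tours by blast
  then obtain q where q: "finite (set_pmf q)" "set_pmf q \<subseteq> Collect is_tour"
    "\<And>e. e \<in> E \<Longrightarrow> measure_pmf.expectation q (\<lambda>K. real (count K e)) = 3 / 2 * x e"
    using fill_slack[where P = is_tour and q = q0 and z = "\<lambda>e. 3 / 2 * x e", OF finE is_tour_double] by blast
  have tour: "st_tour V (support_edges V x) s t K" if K: "is_tour K" for K
    unfolding st_tour_def
  proof (intro conjI)
    have KE: "set_mset K \<subseteq> E" using K by (simp add: is_tour_def)
    then show "set_mset K \<subseteq> support_edges V x" by (simp add: E_def)
    show "multigraph_connected V K"
      unfolding multigraph_connected_def
    proof (intro ballI, rule ccontr)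
      fix u v assume uv: "u \<in> V" "v \<in> V" and not: "(u, v) \<notin> {(a, b). {a, b} \<in># K}\<^sup>*"
      \<comment> \<open>The set reachable from \<open>u\<close> would be a proper vertex set that no
        edge of \<open>K\<close> crosses.\<close>
      define X where "X = {w\<in>V. (u, w) \<in> {(a, b). {a, b} \<in># K}\<^sup>*}"
      have "X \<subseteq> V" "X \<noteq> {}" "X \<noteq> V" using uv not by (auto simp: X_def)
      then obtain e where e: "e \<in># K" "crosses l r X e"
        using K unfolding is_tour_def connected_edges_def by blast
      have eP: "e \<in> vertex_pairs V" using e KE EP by auto
      have "{l e, r e} \<in># K" "{r e, l e} \<in># K" using lr[OF eP] e(1) by (simp_all add: insert_commute)
      then have "(l e, r e) \<in> {(a, b). {a, b} \<in># K}" "(r e, l e) \<in> {(a, b). {a, b} \<in># K}" by auto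
      then have "l e \<in> X \<longleftrightarrow> r e \<in> X"
        using inV[OF eP] unfolding X_def inside_def by (auto intro: rtrancl_into_rtrancl)
      then show False using e(2) by (simp add: crosses_def)
    qed
    have "filter_mset (\<lambda>e. v \<in> e) K = filter_mset (crosses l r {v}) K" for v
    proof (rule filter_mset_cong[OF refl])
      fix e assume "e \<in># K"
      then have "e \<in> vertex_pairs V" using KE EP by auto
      then have e: "e = {l e, r e}" "l e \<noteq> r e" using lr by auto
      have "v \<in> e \<longleftrightarrow> v = l e \<or> v = r e" using arg_cong[OF e(1), of "\<lambda>A. v \<in> A"] by simp
      then show "v \<in> e \<longleftrightarrow> crosses l r {v} e" using e(2) by (auto simp: crosses_def)
    qed
    then have "{v \<in> V. odd (multigraph_degree K v)} = {s, t}"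
      using K unfolding is_tour_def multigraph_degree_def by simp
    then show "{v \<in> V. odd (multigraph_degree K v)} = sym_diff {s} {t}"
      using \<open>s \<noteq> t\<close> by auto
  qed
  show ?thesis
    unfolding convex_comb_of_incidence_vectors_def
  proof (intro exI[of _ "set_pmf q"] exI[of _ "pmf q"] conjI ballI)
    show "set_pmf q \<subseteq> {J. st_tour V (support_edges V x) s t J}" using q(2) tour by blast
    show "(\<Sum>J\<in>set_pmf q. pmf q J) = 1" using q(1) by (simp add: sum_pmf_eq_1)
    fix e assume e: "e \<in> vertex_pairs V"
    show "3 / 2 * x e = (\<Sum>J\<in>set_pmf q. pmf q J * real (count J e))"
    proof (cases "e \<in> E")
      case True
      then show ?thesis using q(1) q(3)[OF True] by (simp add: integral_measure_pmf[of "set_pmf q"])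
    next
      case False
      have "count J e = 0" if "J \<in> set_pmf q" for J
      proof -
        have "is_tour J" using q(2) that by blast
        then have "set_mset J \<subseteq> E" by (simp add: is_tour_def)
        then show ?thesis using False by (auto simp: count_eq_zero_iff)
      qed
      then show ?thesis using x0 e False by simp
    qed
  qed (use q(1) in auto)
qed

end
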